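(* For any finite poset $\mathcal{P}=(\{1,\ldots,n\},\preceq)$ there are isomorphisms of $K$-algebras \[ A \cong\begin{pmatrix} R' & 0 \\ R'& K\mathrm{Id}_n \end{pmatrix} \hookrightarrow \begin{pmatrix} K\mathcal{P} & K^{\mathbf{1}}_0\mathcal{P} \\ K\mathcal{P}&K^{\mathbf{1}}\mathcal{P} \end{pmatrix} \cong \mathcal{L}, \] where $\mathcal{L}$ is the left Burt-Butler algebra of the bocs $(A,U)$ associated to $\mathcal{P}$, and the middle arrow is the inclusion of subalgebras of $\mathbb{M}_{2n}(K)$.
   Context: $K$ is an arbitrary field. $\mathcal{P}=(\{1,\ldots,n\},\preceq)$, $n\geq 1$, is a finite poset such that $i\preceq j$ implies $i\leq j$. Matrix notation: $\mathbb{M}_n(K)$ denotes $n\times n$ matrices over $K$; $R'$ is the algebra of diagonal $n\times n$ matrices; the incidence algebra is $K\mathcal{P}=\{M\in\mathbb{M}_n(K)\mid M_{ji}\neq 0 \text{ implies } i\preceq j\}$. With $\mathbf{1}=[1,\ldots,1]^{\mathrm{tr}}\in K^n$, the row-balanced incidence algebra is $K^{\mathbf{1}}\mathcal{P}=\{M\in K\mathcal{P}\mid M\mathbf{1}\in K\mathbf{1}\}$ and the row-centralized subspace is $K^{\mathbf{1}}_0\mathcal{P}=\{M\in K\mathcal{P}\mid M\mathbf{1}=0\}$. The bocs $(A,U)$ associated to $\mathcal{P}$: let $T=KQ$ be the path algebra (arrows composed from right to left) of the quiver $Q$ with vertices $0,1,\ldots,n$, arrows $\alpha_i:i\to 0$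 for $i\in\mathcal{P}$ and arrows $v_{ij}:j\to i$ for each $i\prec j$; $e_0,\ldots,e_n$ are the trivial paths. Grade $T$ by $|e_i|=|\alpha_i|=0$, $|v_{ij}|=1$. Let $A:=T_0$ (with basis $e_0,\ldots,e_n,\alpha_1,\ldots,\alpha_n$, $\alpha_i=e_0\alpha_ie_i$) and $V:=T_1$ (with basis $v_{ij},\alpha_iv_{ij}$, $i\prec j$); then $T\cong T_A(V)$, in particular $T_2\cong V\otimes_AV$. Let $\delta:T\to T$ be the degree one linear map with $\delta(ab)=\delta(a)b+(-1)^{|a|}a\delta(b)$ for homogeneous $a,b$, determined by $\delta(e_i)=0$, $\delta(\alpha_i)=-\sum_{h\prec i}\alpha_hv_{hi}$, $\delta(v_{ij})=\sum_{i\prec k\prec j}v_{ik}v_{kj}$ (one has $\delta^2=0$). Put $U:=\omega A\oplus V$ for a symbol $\omega$, an $A$-$A$-bimodule via $a(\omega b+v)=\omega ab+\delta(a)b+av$ and $(\omega b+v)a=\omega ba+va$, with counit $\epsilon:U\to A$, $\epsilon(\omega b+v)=b$, and comultiplication $\mu:U\to U\otimes_AU$, $\mu(\omega b+v)=\omega\otimes\omega b+\delta(v)+\omega\otimes v+v\otimes\omega$. The left Burt-Butler algebra $\mathcal{L}$ is the vector space $\mathrm{Hom}_A(U_A,A_A)$ of right $A$-module maps with product $(\psi\varphi)(u)=\sum_t\psi(\varphi(u^1_t)u^2_t)$ where $\mu(u)=\sum_t u^1_t\otimes u^2_t$; its identity is $\epsilon$. *)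

theory Defs
  imports
    "Jordan_Normal_Form.VS_Connect"
    "HOL-Algebra.QuotRing"
    "HOL-Algebra.Subrings"
    "HOL-Algebra.Generated_Groups"
    "HOL-Algebra.Free_Abelian_Groups"
    "HOL-Library.Poly_Mapping"
begin

section \<open>Algebras over a field\<close>

text \<open>The locale \<^locale>\<open>algebra\<close> of the library only covers commutative algebras. The
  following predicate describes associative unital algebras over the field \<^typ>\<open>'k\<close>; the
  record \<^term>\<open>class_ring\<close> is that field.\<close>

definition k_algebra :: "('k::field, 'm) module \<Rightarrow> bool" where
  "k_algebra M \<longleftrightarrow> ring M \<and> Module.module class_ring M \<and>
     (\<forall>c. \<forall>x\<in>carrier M. \<forall>y\<in>carrier M.
        (c \<odot>\<^bsub>M\<^esub> x) \<otimes>\<^bsub>M\<^esub> y = c \<odot>\<^bsub>M\<^esub> (x \<otimes>\<^bsub>M\<^esub> y) \<and>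
        x \<otimes>\<^bsub>M\<^esub> (c \<odot>\<^bsub>M\<^esub> y) = c \<odot>\<^bsub>M\<^esub> (x \<otimes>\<^bsub>M\<^esub> y))"

definition k_subalgebra :: "'m set \<Rightarrow> ('k::field, 'm) module \<Rightarrow> bool" where
  "k_subalgebra S M \<longleftrightarrow> subring S M \<and> (\<forall>c. \<forall>x\<in>S. c \<odot>\<^bsub>M\<^esub> x \<in> S)"

definition k_algebra_iso ::
  "('k::field, 'm) module \<Rightarrow> ('k, 'l) module \<Rightarrow> ('m \<Rightarrow> 'l) set" where
  "k_algebra_iso M N =
     {h \<in> ring_iso M N. \<forall>c. \<forall>x\<in>carrier M. h (c \<odot>\<^bsub>M\<^esub> x) = c \<odot>\<^bsub>N\<^esub> h x}"

definition k_algebra_isomorphic ::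
  "('k::field, 'm) module \<Rightarrow> ('k, 'l) module \<Rightarrow> bool" where
  "k_algebra_isomorphic M N \<longleftrightarrow> k_algebra M \<and> k_algebra N \<and> k_algebra_iso M N \<noteq> {}"


section \<open>Incidence algebras as matrices\<close>

text \<open>The poset is given by its order relation \<open>r\<close> on \<open>{1..n}\<close>, where \<open>(i, j) \<in> r\<close> means
  \<open>i \<preceq> j\<close>. Rows and columns of a matrix are counted from \<open>0\<close>, so the entry \<open>M\<^sub>j\<^sub>i\<close> for
  \<open>i, j \<in> {1..n}\<close> is \<open>M $$ (j - 1, i - 1)\<close>.\<close>

definition ones_vec :: "nat \<Rightarrow> 'k::field vec" where
  "ones_vec n = vec n (\<lambda>_. 1)"

definition diag_matrices :: "nat \<Rightarrow> 'k::field mat set" where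
  "diag_matrices n = {M \<in> carrier_mat n n. diagonal_mat M}"

definition scalar_matrices :: "nat \<Rightarrow> 'k::field mat set" where
  "scalar_matrices n = {c \<cdot>\<^sub>m 1\<^sub>m n | c. True}"

definition incidence_alg :: "nat \<Rightarrow> nat rel \<Rightarrow> 'k::field mat set" where
  "incidence_alg n r = {M \<in> carrier_mat n n.
     \<forall>i\<in>{1..n}. \<forall>j\<in>{1..n}. M $$ (j - 1, i - 1) \<noteq> 0 \<longrightarrow> (i, j) \<in> r}"

definition row_balanced :: "nat \<Rightarrow> nat rel \<Rightarrow> 'k::field mat set" where
  "row_balanced n r = {M \<in> incidence_alg n r. \<exists>c. M *\<^sub>v ones_vec n = c \<cdot>\<^sub>v ones_vec n}"

definition row_centralized :: "nat \<Rightarrow> nat rel \<Rightarrow> 'k::field mat set" where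
  "row_centralized n r = {M \<in> incidence_alg n r. M *\<^sub>v ones_vec n = 0\<^sub>v n}"

definition block_matrices ::
  "'k mat set \<Rightarrow> 'k mat set \<Rightarrow> 'k mat set \<Rightarrow> 'k mat set \<Rightarrow> 'k::field mat set" where
  "block_matrices S11 S12 S21 S22 =
     {four_block_mat B11 B12 B21 B22 | B11 B12 B21 B22.
        B11 \<in> S11 \<and> B12 \<in> S12 \<and> B21 \<in> S21 \<and> B22 \<in> S22}"

definition small_block_alg :: "nat \<Rightarrow> 'k::field mat set" where
  "small_block_alg n =
     block_matrices (diag_matrices n) {0\<^sub>m n n} (diag_matrices n) (scalar_matrices n)"

definition large_block_alg :: "nat \<Rightarrow> nat rel \<Rightarrow> 'k::field mat set" where
  "large_block_alg n r =
     block_matrices (incidence_alg n r) (row_centralized n r)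
                    (incidence_alg n r) (row_balanced n r)"


section \<open>The graded path algebra of the quiver\<close>

text \<open>\<open>Alpha i\<close> is the arrow \<open>\<alpha>\<^sub>i : i \<rightarrow> 0\<close> and \<open>Vee i j\<close> is the arrow \<open>v\<^sub>i\<^sub>j : j \<rightarrow> i\<close>.\<close>

datatype arrow = Alpha nat | Vee nat nat

fun arrow_source :: "arrow \<Rightarrow> nat" where
  "arrow_source (Alpha i) = i"
| "arrow_source (Vee i j) = j"

fun arrow_target :: "arrow \<Rightarrow> nat" where
  "arrow_target (Alpha i) = 0"
| "arrow_target (Vee i j) = i"

fun arrow_degree :: "arrow \<Rightarrow> nat" where
  "arrow_degree (Alpha i) = 0"
| "arrow_degree (Vee i j) = 1"

definition quiver_arrows :: "nat \<Rightarrow> nat rel \<Rightarrow> arrow set" where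
  "quiver_arrows n r = {Alpha i | i. i \<in> {1..n}} \<union> {Vee i j | i j. (i, j) \<in> r \<and> i \<noteq> j}"

text \<open>A path is a list of arrows together with its source vertex. As arrows are composed from
  right to left, the last arrow of the list is traversed first. The trivial path at \<open>i\<close> is
  \<open>([], i)\<close>.\<close>

type_synonym qpath = "arrow list \<times> nat"

fun path_source :: "qpath \<Rightarrow> nat" where
  "path_source (as, s) = s"

fun path_target :: "qpath \<Rightarrow> nat" where
  "path_target ([], s) = s"
| "path_target (a # as, s) = arrow_target a"

fun path_degree :: "qpath \<Rightarrow> nat" where
  "path_degree (as, s) = sum_list (map arrow_degree as)"

fun path_comp :: "qpath \<Rightarrow> qpath \<Rightarrow> qpath" where
  "path_comp (as, s) (bs, t) = (as @ bs, t)"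

fun is_path :: "nat \<Rightarrow> nat rel \<Rightarrow> qpath \<Rightarrow> bool" where
  "is_path n r ([], s) \<longleftrightarrow> s \<in> {0..n}"
| "is_path n r (a # as, s) \<longleftrightarrow>
     a \<in> quiver_arrows n r \<and> arrow_source a = path_target (as, s) \<and> is_path n r (as, s)"

definition path_alg :: "nat \<Rightarrow> nat rel \<Rightarrow> (qpath \<Rightarrow>\<^sub>0 'k::field) set" where
  "path_alg n r = {x. \<forall>p\<in>Poly_Mapping.keys x. is_path n r p}"

definition path_alg_degree :: "nat \<Rightarrow> nat rel \<Rightarrow> nat \<Rightarrow> (qpath \<Rightarrow>\<^sub>0 'k::field) set" where
  "path_alg_degree n r d = {x \<in> path_alg n r. \<forall>p\<in>Poly_Mapping.keys x. path_degree p = d}"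

definition pscale :: "'k::field \<Rightarrow> (qpath \<Rightarrow>\<^sub>0 'k) \<Rightarrow> (qpath \<Rightarrow>\<^sub>0 'k)"  (infixr \<open>\<cdot>\<^sub>p\<close> 75) where
  "c \<cdot>\<^sub>p x = Poly_Mapping.map (\<lambda>y. c * y) x"

abbreviation basis_path :: "qpath \<Rightarrow> (qpath \<Rightarrow>\<^sub>0 'k::field)" where
  "basis_path p \<equiv> Poly_Mapping.single p 1"

text \<open>The linear extension of a map defined on the paths.\<close>

definition plinear :: "(qpath \<Rightarrow> (qpath \<Rightarrow>\<^sub>0 'k)) \<Rightarrow> (qpath \<Rightarrow>\<^sub>0 'k::field) \<Rightarrow> (qpath \<Rightarrow>\<^sub>0 'k)" where
  "plinear F x = (\<Sum>p\<in>Poly_Mapping.keys x. Poly_Mapping.lookup x p \<cdot>\<^sub>p F p)"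

definition pmult :: "(qpath \<Rightarrow>\<^sub>0 'k::field) \<Rightarrow> (qpath \<Rightarrow>\<^sub>0 'k) \<Rightarrow> (qpath \<Rightarrow>\<^sub>0 'k)"
    (infixl \<open>\<star>\<close> 70) where
  "x \<star> y = plinear (\<lambda>p. plinear (\<lambda>q.
     if path_source p = path_target q then basis_path (path_comp p q) else 0) y) x"

definition path_one :: "nat \<Rightarrow> (qpath \<Rightarrow>\<^sub>0 'k::field)" where
  "path_one n = (\<Sum>i\<in>{0..n}. basis_path ([], i))"


section \<open>The differential\<close>

fun diff_arrow :: "nat rel \<Rightarrow> arrow \<Rightarrow> (qpath \<Rightarrow>\<^sub>0 'k::field)" where
  "diff_arrow r (Alpha i) =
     - (\<Sum>h\<in>{h. (h, i) \<in> r \<and> h \<noteq> i}. basis_path ([Alpha h, Vee h i], i))"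
| "diff_arrow r (Vee i j) =
     (\<Sum>k\<in>{k. (i, k) \<in> r \<and> i \<noteq> k \<and> (k, j) \<in> r \<and> k \<noteq> j}. basis_path ([Vee i k, Vee k j], j))"

text \<open>On a path the differential is obtained from its values on arrows by applying the graded
  Leibniz rule to the leftmost arrow.\<close>

fun diff_path :: "nat rel \<Rightarrow> qpath \<Rightarrow> (qpath \<Rightarrow>\<^sub>0 'k::field)" where
  "diff_path r ([], s) = 0"
| "diff_path r (a # as, s) =
     diff_arrow r a \<star> basis_path (as, s)
     + (- 1) ^ arrow_degree a \<cdot>\<^sub>p (basis_path ([a], arrow_source a) \<star> diff_path r (as, s))"

definition bocs_diff :: "nat rel \<Rightarrow> (qpath \<Rightarrow>\<^sub>0 'k::field) \<Rightarrow> (qpath \<Rightarrow>\<^sub>0 'k)" where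
  "bocs_diff r = plinear (diff_path r)"

text \<open>It is shown below that \<^term>\<open>bocs_diff\<close> satisfies the graded Leibniz rule for arbitrary
  homogeneous left factors.\<close>

lemma lookup_pscale [simp]: "Poly_Mapping.lookup (c \<cdot>\<^sub>p x) p = c * Poly_Mapping.lookup x p"
  by (simp add: pscale_def map.rep_eq when_def)

lemma pscale_simps [simp]:
  "c \<cdot>\<^sub>p (0 :: qpath \<Rightarrow>\<^sub>0 'k::field) = 0" "0 \<cdot>\<^sub>p x = 0" "1 \<cdot>\<^sub>p x = x"
  "c \<cdot>\<^sub>p d \<cdot>\<^sub>p x = (c * d) \<cdot>\<^sub>p x"
  by (rule poly_mapping_eqI, simp)+

lemma pscale_add: "c \<cdot>\<^sub>p (x + y) = c \<cdot>\<^sub>p x + c \<cdot>\<^sub>p y" "(c + d) \<cdot>\<^sub>p x = c \<cdot>\<^sub>p x + d \<cdot>\<^sub>p x"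
  by (rule poly_mapping_eqI, simp add: lookup_add algebra_simps)+

lemma pscale_sum: "c \<cdot>\<^sub>p sum f S = (\<Sum>s\<in>S. c \<cdot>\<^sub>p f s)"
  by (induction S rule: infinite_finite_induct) (simp_all add: pscale_add)

lemma plinear_superset:
  assumes "finite S" "Poly_Mapping.keys x \<subseteq> S"
  shows "plinear F x = (\<Sum>p\<in>S. Poly_Mapping.lookup x p \<cdot>\<^sub>p F p)"
  unfolding plinear_def using assms
  by (intro sum.mono_neutral_left) (auto simp: in_keys_iff)

lemma plinear_add: "plinear F (x + y) = plinear F x + plinear F y"
proof -
  let ?S = "Poly_Mapping.keys x \<union> Poly_Mapping.keys y"
  have "Poly_Mapping.keys (x + y) \<subseteq> ?S" by (rule Poly_Mapping.keys_add)
  then show ?thesis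
    by (simp add: plinear_superset[of ?S] lookup_add pscale_add sum.distrib)
qed

lemma plinear_scale: "plinear F (c \<cdot>\<^sub>p x) = c \<cdot>\<^sub>p plinear F x"
proof -
  have "Poly_Mapping.keys (c \<cdot>\<^sub>p x) \<subseteq> Poly_Mapping.keys x" by (auto simp: in_keys_iff)
  then show ?thesis
    by (simp add: plinear_superset[of "Poly_Mapping.keys x"] pscale_sum)
qed

lemma plinear_0 [simp]: "plinear F 0 = 0"
  by (simp add: plinear_def)

lemma plinear_basis [simp]: "plinear F (basis_path p) = F p"
  by (simp add: plinear_def)

lemma plinear_sum: "plinear F (sum f S) = (\<Sum>s\<in>S. plinear F (f s))"
  by (induction S rule: infinite_finite_induct) (simp_all add: plinear_add)

lemma plinear_uminus: "plinear F (- x) = - plinear F x"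
  using plinear_add[of F x "- x"] by (simp add: eq_neg_iff_add_eq_0 add.commute)

lemma pscale_single: "c \<cdot>\<^sub>p basis_path p = Poly_Mapping.single p c"
  by (rule poly_mapping_eqI) (simp add: lookup_single when_def)

lemma basis_expansion: "x = (\<Sum>p\<in>Poly_Mapping.keys x. Poly_Mapping.lookup x p \<cdot>\<^sub>p basis_path p)"
  by (rule poly_mapping_eqI)
    (simp add: lookup_sum lookup_single when_def in_keys_iff sum.delta' if_distrib cong: if_cong)

lemma pmult_add_left: "(x + y) \<star> z = x \<star> z + y \<star> z"
  by (simp add: pmult_def plinear_add)

lemma pmult_scale_left: "(c \<cdot>\<^sub>p x) \<star> z = c \<cdot>\<^sub>p (x \<star> z)"
  by (simp add: pmult_def plinear_scale)

lemma pmult_0_left [simp]: "0 \<star> z = 0"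
  by (simp add: pmult_def)

lemma pmult_sum_left: "sum f S \<star> z = (\<Sum>s\<in>S. f s \<star> z)"
  by (simp add: pmult_def plinear_sum)

lemma pmult_add_right: "z \<star> (x + y) = z \<star> x + z \<star> y"
  by (simp add: pmult_def plinear_add) (simp add: plinear_def pscale_add sum.distrib)

lemma pmult_scale_right: "z \<star> (c \<cdot>\<^sub>p x) = c \<cdot>\<^sub>p (z \<star> x)"
  by (simp add: pmult_def plinear_scale) (simp add: plinear_def pscale_sum ac_simps)

lemma pmult_0_right [simp]: "z \<star> 0 = 0"
  by (simp add: pmult_def) (simp add: plinear_def)

lemma pmult_sum_right: "z \<star> sum f S = (\<Sum>s\<in>S. z \<star> f s)"
  by (induction S rule: infinite_finite_induct) (simp_all add: pmult_add_right)

lemma pmult_basis: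
  "basis_path p \<star> basis_path q =
     (if path_source p = path_target q then basis_path (path_comp p q) else 0)"
  by (simp add: pmult_def)

lemma path_ends_comp:
  "path_source (path_comp p q) = path_source q"
  "path_source p = path_target q \<Longrightarrow> path_target (path_comp p q) = path_target p"
  by (cases p; cases q; cases "fst p"; auto)+

lemma pmult_assoc: "(x \<star> y) \<star> z = x \<star> (y \<star> z)"
proof -
  have comp: "path_comp (path_comp p q) s = path_comp p (path_comp q s)" for p q s
    by (cases p; cases q; cases s) auto
  have basis: "(basis_path p \<star> basis_path q) \<star> basis_path s =
      basis_path p \<star> (basis_path q \<star> (basis_path s :: qpath \<Rightarrow>\<^sub>0 'a))" for p q s
    by (simp add: pmult_basis path_ends_comp comp)
  have 1: "(basis_path p \<star> basis_path q) \<star> z = basis_path p \<star> (basis_path q \<star> z)" for p q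
    by (subst (1 2) basis_expansion[of z])
      (simp add: pmult_sum_right pmult_scale_right basis)
  have 2: "(basis_path p \<star> y) \<star> z = basis_path p \<star> (y \<star> z)" for p
    by (subst (1 2) basis_expansion[of y])
      (simp add: pmult_sum_right pmult_sum_left pmult_scale_right pmult_scale_left 1)
  show ?thesis
    by (subst (1 2) basis_expansion[of x])
      (simp add: pmult_sum_left pmult_scale_left 2)
qed

lemma path_target_basis_mult:
  "basis_path ([], t) \<star> basis_path p = (if t = path_target p then basis_path p else 0)"
  by (cases p) (simp add: pmult_basis)

lemma path_source_basis_mult:
  "basis_path p \<star> basis_path ([], t) = (if t = path_source p then basis_path p else 0)"
  by (cases p) (simp add: pmult_basis)

lemma diff_arrow_ends:
  "basis_path ([], arrow_target a) \<star> diff_arrow r a = (diff_arrow r a :: qpath \<Rightarrow>\<^sub>0 'k::field)"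
  "diff_arrow r a \<star> basis_path ([], arrow_source a) = (diff_arrow r a :: qpath \<Rightarrow>\<^sub>0 'k::field)"
proof -
  have neg: "x \<star> (- y) = - (x \<star> y)" "(- x) \<star> y = - (x \<star> y)" for x y :: "qpath \<Rightarrow>\<^sub>0 'k"
    using pmult_add_right[of x y "- y"] pmult_add_left[of x "- x" y]
    by (simp_all add: eq_neg_iff_add_eq_0 add.commute)
  show "basis_path ([], arrow_target a) \<star> diff_arrow r a = (diff_arrow r a :: qpath \<Rightarrow>\<^sub>0 'k)"
    by (cases a) (simp_all add: pmult_sum_right neg path_target_basis_mult)
  show "diff_arrow r a \<star> basis_path ([], arrow_source a) = (diff_arrow r a :: qpath \<Rightarrow>\<^sub>0 'k)"
    by (cases a) (simp_all add: pmult_sum_left neg path_source_basis_mult)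
qed

lemma diff_path_ends:
  "basis_path ([], path_target p) \<star> diff_path r p = (diff_path r p :: qpath \<Rightarrow>\<^sub>0 'k::field)"
  "diff_path r p \<star> basis_path ([], path_source p) = (diff_path r p :: qpath \<Rightarrow>\<^sub>0 'k::field)"
proof -
  obtain as s where p: "p = (as, s)" by (cases p)
  have "basis_path ([], path_target (as, s)) \<star> diff_path r (as, s) =
        (diff_path r (as, s) :: qpath \<Rightarrow>\<^sub>0 'k)"
    by (cases as)
      (simp_all add: pmult_add_right pmult_scale_right pmult_assoc[symmetric] diff_arrow_ends
        path_target_basis_mult)
  moreover have "diff_path r (as, s) \<star> basis_path ([], s) = (diff_path r (as, s) :: qpath \<Rightarrow>\<^sub>0 'k)"
    by (induction as)
      (simp_all add: pmult_add_left pmult_scale_left pmult_assoc path_source_basis_mult)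
  ultimately show "basis_path ([], path_target p) \<star> diff_path r p = (diff_path r p :: qpath \<Rightarrow>\<^sub>0 'k)"
    "diff_path r p \<star> basis_path ([], path_source p) = (diff_path r p :: qpath \<Rightarrow>\<^sub>0 'k)"
    by (simp_all add: p)
qed

lemma bocs_diff_basis [simp]: "bocs_diff r (basis_path p) = diff_path r p"
  by (simp add: bocs_diff_def)

lemma bocs_diff_linear:
  "bocs_diff r (x + y) = bocs_diff r x + bocs_diff r y"
  "bocs_diff r (c \<cdot>\<^sub>p x) = c \<cdot>\<^sub>p bocs_diff r x"
  "bocs_diff r (sum f S) = (\<Sum>s\<in>S. bocs_diff r (f s))"
  "bocs_diff r 0 = 0"
  by (simp_all add: bocs_diff_def plinear_add plinear_scale plinear_sum)

lemma bocs_diff_generators: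
  "bocs_diff r (basis_path ([], i)) = 0"
  "bocs_diff r (basis_path ([a], arrow_source a)) = diff_arrow r a"
  by (simp_all add: diff_arrow_ends)

lemma Leibniz_paths:
  assumes "is_path n r p"
  shows "bocs_diff r (basis_path p \<star> basis_path q) =
    diff_path r p \<star> basis_path q + (- 1) ^ path_degree p \<cdot>\<^sub>p (basis_path p \<star> (diff_path r q :: qpath \<Rightarrow>\<^sub>0 'k::field))"
proof (cases "path_source p = path_target q")
  case False
  then have neq: "path_target q \<noteq> path_source p" by simp
  have "diff_path r p \<star> basis_path q = (0 :: qpath \<Rightarrow>\<^sub>0 'k)"
    by (subst diff_path_ends(2)[symmetric])
      (simp add: pmult_assoc path_target_basis_mult False)
  moreover have "basis_path p \<star> diff_path r q = (0 :: qpath \<Rightarrow>\<^sub>0 'k)"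
    by (subst diff_path_ends(1)[symmetric])
      (simp add: pmult_assoc[symmetric] path_source_basis_mult neq)
  ultimately show ?thesis using False by (simp add: pmult_basis bocs_diff_linear)
next
  case True
  obtain as s where p: "p = (as, s)" by (cases p)
  obtain bs t where q: "q = (bs, t)" by (cases q)
  have s: "s = path_target q" using True p by simp
  have "is_path n r (as, s) \<Longrightarrow> diff_path r (as @ bs, t) =
    diff_path r (as, s) \<star> basis_path q
    + (- 1) ^ path_degree (as, s) \<cdot>\<^sub>p (basis_path (as, s) \<star> (diff_path r q :: qpath \<Rightarrow>\<^sub>0 'k))"
  proof (induction as)
    case Nil
    have "basis_path ([], path_target q) \<star> diff_path r q = (diff_path r q :: qpath \<Rightarrow>\<^sub>0 'k)"
      by (rule diff_path_ends)
    then show ?case using s q by simp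
  next
    case (Cons a as)
    have 1: "basis_path (as @ bs, t) = basis_path (as, s) \<star> (basis_path q :: qpath \<Rightarrow>\<^sub>0 'k)"
      using s q by (simp add: pmult_basis)
    have 2: "basis_path (a # as, s) =
        basis_path ([a], arrow_source a) \<star> (basis_path (as, s) :: qpath \<Rightarrow>\<^sub>0 'k)"
      using Cons.prems by (simp add: pmult_basis)
    have IH: "diff_path r (as @ bs, t) = diff_path r (as, s) \<star> basis_path q
      + (- 1) ^ path_degree (as, s) \<cdot>\<^sub>p (basis_path (as, s) \<star> (diff_path r q :: qpath \<Rightarrow>\<^sub>0 'k))"
      using Cons by simp
    show ?case
      by (simp add: 1 2 IH pmult_assoc pmult_add_left pmult_add_right pmult_scale_left
          pmult_scale_right pscale_add power_add add.assoc)
  qed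
  then show ?thesis using True assms p q by (simp add: pmult_basis)
qed

lemma bocs_diff_Leibniz:
  assumes "x \<in> path_alg_degree n r d"
  shows "bocs_diff r (x \<star> y) = bocs_diff r x \<star> y + (- 1) ^ d \<cdot>\<^sub>p (x \<star> bocs_diff r y)"
proof -
  have 1: "bocs_diff r (basis_path p \<star> y) =
      diff_path r p \<star> y + (- 1) ^ d \<cdot>\<^sub>p (basis_path p \<star> bocs_diff r y)"
    if "p \<in> Poly_Mapping.keys x" for p
  proof -
    have p: "is_path n r p" "path_degree p = d"
      using that assms by (auto simp: path_alg_degree_def path_alg_def)
    show ?thesis
      by (subst (1 2 3) basis_expansion[of y])
        (simp add: pmult_sum_right pmult_scale_right bocs_diff_linear Leibniz_paths[OF p(1)] p(2)
          pscale_sum pscale_add sum.distrib mult.commute)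
  qed
  show ?thesis
    by (subst (1 2 3) basis_expansion[of x])
      (simp add: pmult_sum_left pmult_scale_left bocs_diff_linear 1
        pscale_sum pscale_add sum.distrib mult.commute)
qed

section \<open>The bocs\<close>

definition bocs_A :: "nat \<Rightarrow> nat rel \<Rightarrow> (qpath \<Rightarrow>\<^sub>0 'k::field) set" where
  "bocs_A n r = path_alg_degree n r 0"

definition bocs_V :: "nat \<Rightarrow> nat rel \<Rightarrow> (qpath \<Rightarrow>\<^sub>0 'k::field) set" where
  "bocs_V n r = path_alg_degree n r 1"

definition bocs_A_algebra :: "nat \<Rightarrow> nat rel \<Rightarrow> ('k::field, qpath \<Rightarrow>\<^sub>0 'k) module" where
  "bocs_A_algebra n r =
     \<lparr>carrier = bocs_A n r, mult = (\<star>), one = path_one n, ring.zero = 0, ring.add = (+), smult = (\<cdot>\<^sub>p)\<rparr>"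

text \<open>The pair \<open>(b, v)\<close> stands for \<open>\<omega> b + v\<close>.\<close>

type_synonym 'k bocs_elt = "(qpath \<Rightarrow>\<^sub>0 'k) \<times> (qpath \<Rightarrow>\<^sub>0 'k)"

definition bocs_U :: "nat \<Rightarrow> nat rel \<Rightarrow> 'k::field bocs_elt set" where
  "bocs_U n r = bocs_A n r \<times> bocs_V n r"

fun uadd :: "'k::field bocs_elt \<Rightarrow> 'k bocs_elt \<Rightarrow> 'k bocs_elt" where
  "uadd (b, v) (b', v') = (b + b', v + v')"

fun uleft :: "nat rel \<Rightarrow> (qpath \<Rightarrow>\<^sub>0 'k::field) \<Rightarrow> 'k bocs_elt \<Rightarrow> 'k bocs_elt" where
  "uleft r a (b, v) = (a \<star> b, bocs_diff r a \<star> b + a \<star> v)"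

fun uright :: "'k::field bocs_elt \<Rightarrow> (qpath \<Rightarrow>\<^sub>0 'k) \<Rightarrow> 'k bocs_elt" where
  "uright (b, v) a = (b \<star> a, v \<star> a)"

fun counit :: "'k::field bocs_elt \<Rightarrow> (qpath \<Rightarrow>\<^sub>0 'k)" where
  "counit (b, v) = b"

definition omega :: "nat \<Rightarrow> 'k::field bocs_elt" where
  "omega n = (path_one n, 0)"

text \<open>The tensor product \<open>U \<otimes>\<^sub>A U\<close> is the quotient of the free abelian group on \<open>U \<times> U\<close> by
  the subgroup generated by the following relations. Its elements are cosets.\<close>

definition tensor_relations :: "nat \<Rightarrow> nat rel \<Rightarrow> (('k::field bocs_elt \<times> 'k bocs_elt) \<Rightarrow>\<^sub>0 int) set"
  where
  "tensor_relations n r =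
     {frag_of (uadd u u', w) - frag_of (u, w) - frag_of (u', w) | u u' w.
        u \<in> bocs_U n r \<and> u' \<in> bocs_U n r \<and> w \<in> bocs_U n r} \<union>
     {frag_of (u, uadd w w') - frag_of (u, w) - frag_of (u, w') | u w w'.
        u \<in> bocs_U n r \<and> w \<in> bocs_U n r \<and> w' \<in> bocs_U n r} \<union>
     {frag_of (uright u a, w) - frag_of (u, uleft r a w) | u a w.
        u \<in> bocs_U n r \<and> a \<in> bocs_A n r \<and> w \<in> bocs_U n r}"

definition tensor_class ::
  "nat \<Rightarrow> nat rel \<Rightarrow> (('k::field bocs_elt \<times> 'k bocs_elt) \<Rightarrow>\<^sub>0 int) \<Rightarrow>
   (('k bocs_elt \<times> 'k bocs_elt) \<Rightarrow>\<^sub>0 int) set" where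
  "tensor_class n r z =
     (let F = free_Abelian_group (bocs_U n r \<times> bocs_U n r)
      in generate F (tensor_relations n r) #>\<^bsub>F\<^esub> z)"

text \<open>The identification of \<open>T\<^sub>2\<close> with \<open>V \<otimes>\<^sub>A V\<close>, at the level of formal sums: since the
  first traversed arrow of a path of degree 2 is some \<open>v\<^sub>k\<^sub>j\<close>, such a path is the product
  of the path of degree 1 obtained by removing this arrow with the arrow itself.\<close>

fun path_front :: "qpath \<Rightarrow> qpath" where
  "path_front (as, s) = (butlast as, arrow_target (last as))"

fun path_back :: "qpath \<Rightarrow> qpath" where
  "path_back (as, s) = ([last as], s)"

lemma path_split:
  assumes r: "r \<subseteq> {1..n} \<times> {1..n}" and p: "is_path n r p" "path_degree p = 2"
  shows "is_path n r (path_front p)" "path_degree (path_front p) = 1"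
    "is_path n r (path_back p)" "path_degree (path_back p) = 1"
    "path_comp (path_front p) (path_back p) = p" "path_source (path_front p) = path_target (path_back p)"
proof -
  obtain as s where as: "p = (as, s)" by (cases p)
  have deg: "arrow_degree a \<le> 1" for a by (cases a) auto
  obtain cs a where cs: "as = cs @ [a]" using p as by (cases as rule: rev_cases) auto
  have "cs \<noteq> []" using p deg[of a] by (auto simp: as cs)
  have front: "is_path n r (cs, arrow_target a) \<and> is_path n r ([a], s) \<and> arrow_degree a = 1"
    if "cs \<noteq> []" "is_path n r (cs @ [a], s)" for cs
    using that
  proof (induction cs)
    case (Cons b cs)
    show ?case
    proof (cases "cs = []")
      case True
      then show ?thesis using Cons.prems r
        by (cases a; cases b) (auto simp: quiver_arrows_def)
    next
      case False
      then show ?thesis using Cons by (cases cs) auto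
    qed
  qed simp
  note front = front[OF \<open>cs \<noteq> []\<close> p(1)[unfolded as cs]]
  show "is_path n r (path_front p)" "path_degree (path_front p) = 1"
    "is_path n r (path_back p)" "path_degree (path_back p) = 1"
    "path_comp (path_front p) (path_back p) = p" "path_source (path_front p) = path_target (path_back p)"
    using front p by (auto simp: as cs)
qed

definition split_tensor ::
  "(qpath \<Rightarrow>\<^sub>0 'k::field) \<Rightarrow> (('k bocs_elt \<times> 'k bocs_elt) \<Rightarrow>\<^sub>0 int)" where
  "split_tensor t = (\<Sum>p\<in>Poly_Mapping.keys t.
     frag_of ((0, Poly_Mapping.lookup t p \<cdot>\<^sub>p basis_path (path_front p)),
              (0, basis_path (path_back p))))"

fun comult :: "nat \<Rightarrow> nat rel \<Rightarrow> 'k::field bocs_elt \<Rightarrow> (('k bocs_elt \<times> 'k bocs_elt) \<Rightarrow>\<^sub>0 int) set" where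
  "comult n r (b, v) = tensor_class n r
     (frag_of (omega n, (b, 0)) + split_tensor (bocs_diff r v)
      + frag_of (omega n, (0, v)) + frag_of ((0, v), omega n))"


section \<open>The left Burt-Butler algebra\<close>

definition right_module_maps :: "nat \<Rightarrow> nat rel \<Rightarrow> ('k::field bocs_elt \<Rightarrow> (qpath \<Rightarrow>\<^sub>0 'k)) set" where
  "right_module_maps n r = {\<phi> \<in> bocs_U n r \<rightarrow>\<^sub>E bocs_A n r.
     (\<forall>u\<in>bocs_U n r. \<forall>u'\<in>bocs_U n r. \<phi> (uadd u u') = \<phi> u + \<phi> u') \<and>
     (\<forall>u\<in>bocs_U n r. \<forall>a\<in>bocs_A n r. \<phi> (uright u a) = \<phi> u \<star> a)}"

text \<open>\<open>\<Sum>\<^sub>t \<psi> (\<phi> (u\<^sub>t) w\<^sub>t)\<close> for the formal sum \<open>\<Sum>\<^sub>t u\<^sub>t \<otimes> w\<^sub>t\<close>.\<close>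

definition bb_eval ::
  "nat rel \<Rightarrow> ('k::field bocs_elt \<Rightarrow> (qpath \<Rightarrow>\<^sub>0 'k)) \<Rightarrow> ('k bocs_elt \<Rightarrow> (qpath \<Rightarrow>\<^sub>0 'k)) \<Rightarrow>
   (('k bocs_elt \<times> 'k bocs_elt) \<Rightarrow>\<^sub>0 int) \<Rightarrow> (qpath \<Rightarrow>\<^sub>0 'k)" where
  "bb_eval r \<psi> \<phi> z = (\<Sum>(u, w)\<in>Poly_Mapping.keys z.
     of_int (Poly_Mapping.lookup z (u, w)) \<cdot>\<^sub>p \<psi> (uleft r (\<phi> u) w))"

text \<open>The value of the product at \<open>u\<close> is the common value of \<^term>\<open>bb_eval\<close> on all formal sums
  in the coset \<open>\<mu>(u)\<close>.\<close>

definition bb_mult ::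
  "nat \<Rightarrow> nat rel \<Rightarrow> ('k::field bocs_elt \<Rightarrow> (qpath \<Rightarrow>\<^sub>0 'k)) \<Rightarrow> ('k bocs_elt \<Rightarrow> (qpath \<Rightarrow>\<^sub>0 'k)) \<Rightarrow>
   ('k bocs_elt \<Rightarrow> (qpath \<Rightarrow>\<^sub>0 'k))" where
  "bb_mult n r \<psi> \<phi> = (\<lambda>u\<in>bocs_U n r. the_elem (bb_eval r \<psi> \<phi> ` comult n r u))"

definition left_Burt_Butler ::
  "nat \<Rightarrow> nat rel \<Rightarrow> ('k::field, 'k bocs_elt \<Rightarrow> (qpath \<Rightarrow>\<^sub>0 'k)) module" where
  "left_Burt_Butler n r =
     \<lparr>carrier = right_module_maps n r,
      mult = bb_mult n r,
      one = (\<lambda>u\<in>bocs_U n r. counit u),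
      ring.zero = (\<lambda>u\<in>bocs_U n r. 0),
      ring.add = (\<lambda>\<psi> \<phi>. \<lambda>u\<in>bocs_U n r. \<psi> u + \<phi> u),
      smult = (\<lambda>c \<phi>. \<lambda>u\<in>bocs_U n r. c \<cdot>\<^sub>p \<phi> u)\<rparr>"

end

theory Submission
  imports Defs
begin

text \<open>Both isomorphisms come from reading right-module maps as matrices.

  As a right \<open>A\<close>-module, \<open>U\<close> is the sum of the free module \<open>\<omega>A\<close> and of \<open>V\<close>, whose basis elements
  \<open>v\<^sub>i\<^sub>j\<close> and \<open>\<alpha>\<^sub>iv\<^sub>i\<^sub>j\<close> lie in \<open>Ve\<^sub>j\<close> and are annihilated by the arrows \<open>\<alpha>\<^sub>k\<close> on the right. So a right-module map \<open>\<phi>\<close> is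
  given by an arbitrary \<open>\<phi>(\<omega>) \<in> A\<close> and arbitrary \<open>\<phi>(v\<^sub>i\<^sub>j), \<phi>(\<alpha>\<^sub>iv\<^sub>i\<^sub>j) \<in> Ae\<^sub>j\<close>, where \<open>Ae\<^sub>j\<close> has the basis
  \<open>e\<^sub>j, \<alpha>\<^sub>j\<close> and \<open>Ae\<^sub>0 = Ke\<^sub>0\<close>. The coordinates in \<open>Ae\<^sub>j\<close> are written into the two rows of a \<open>2n \<times> 2n\<close> matrix
  that belong to \<open>j\<close>, one in each half. The values on \<open>v\<^sub>i\<^sub>j\<close> go to the column of \<open>i\<close> in the left half, the
  values on \<open>\<alpha>\<^sub>iv\<^sub>i\<^sub>j\<close> to the column of \<open>i\<close> in the right half, and \<open>\<phi>(\<omega>)e\<^sub>j\<close> fills the diagonals of the left blocks;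
  entries outside the incidence pattern are \<open>0\<close>.
  Only the diagonals of the right blocks are still free, while only the coordinate \<open>c\<close> of \<open>\<phi>(\<omega>)\<close> at \<open>e\<^sub>0\<close> has not
  been used. Those diagonals are filled in such a way that the row sums of the upper right block are \<open>0\<close> and
  those of the lower right block are \<open>c\<close>. This gives a bijection with the large block algebra
  (\<open>bij_betw_matrix_map\<close>).

  With this choice composition becomes matrix multiplication. The comultiplication splits \<open>v\<^sub>i\<^sub>j\<close> into
  \<open>\<omega> \<otimes> v\<^sub>i\<^sub>j\<close>, the terms \<open>v\<^sub>i\<^sub>k \<otimes> v\<^sub>k\<^sub>j\<close> with \<open>i \<prec> k \<prec> j\<close>, and \<open>v\<^sub>i\<^sub>j \<otimes> \<omega>\<close>; they contribute to a matrix product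
  the summands with intermediate vertex \<open>i\<close>, \<open>k\<close> and \<open>j\<close>. The correction is at \<open>v\<^sub>i\<^sub>j \<otimes> \<omega>\<close>, because \<open>a\<omega> = \<omega>a + \<delta>(a)\<close>
  and \<open>\<delta>(\<alpha>\<^sub>j) = - \<Sum>\<^sub>h \<alpha>\<^sub>hv\<^sub>h\<^sub>j\<close>: the coefficient of \<open>\<alpha>\<^sub>j\<close> meets \<open>c\<alpha>\<^sub>j\<close> minus all values on the \<open>\<alpha>\<^sub>hv\<^sub>h\<^sub>j\<close>, and by the
  row sums this is the diagonal column that a matrix product requires (\<open>twisted_column\<close>). The same identity
  absorbs the terms \<open>- \<alpha>\<^sub>hv\<^sub>h\<^sub>i \<otimes> v\<^sub>i\<^sub>j\<close> of \<open>\<mu>(\<alpha>\<^sub>iv\<^sub>i\<^sub>j)\<close> (\<open>gen_image_mat_mult\<close>).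

  Finally, the row sum conditions together say that the vector with upper half \<open>0\<close> and lower half \<open>1\<close> is an
  eigenvector, so the large block algebra is a subalgebra. The small block algebra is the large one for the
  equality order, for which \<open>V = 0\<close>; there the construction reduces to the isomorphism with \<open>A\<close>.\<close>

section \<open>Transport of algebra structures\<close>

text \<open>As \<open>g\<close> is bijective, \<open>N\<close> inherits closure and all algebra axioms from \<open>M\<close>. For the left Burt-Butler
  algebra this takes the place of deducing closure and associativity from the coassociativity of \<open>\<mu>\<close>.\<close>

lemma k_algebra_transport:
  fixes M :: "('a::field, 'm) module"
  assumes M: "k_algebra M"
    and g: "bij_betw g (carrier M) (carrier N)"
    and mult: "\<And>x y. x \<in> carrier M \<Longrightarrow> y \<in> carrier M \<Longrightarrow> g (x \<otimes>\<^bsub>M\<^esub> y) = g x \<otimes>\<^bsub>N\<^esub> g y"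
    and add: "\<And>x y. x \<in> carrier M \<Longrightarrow> y \<in> carrier M \<Longrightarrow> g (x \<oplus>\<^bsub>M\<^esub> y) = g x \<oplus>\<^bsub>N\<^esub> g y"
    and one: "g \<one>\<^bsub>M\<^esub> = \<one>\<^bsub>N\<^esub>"
    and zero: "g \<zero>\<^bsub>M\<^esub> = \<zero>\<^bsub>N\<^esub>"
    and smult: "\<And>c x. x \<in> carrier M \<Longrightarrow> g (c \<odot>\<^bsub>M\<^esub> x) = c \<odot>\<^bsub>N\<^esub> g x"
  shows "k_algebra_isomorphic M N" "k_algebra_isomorphic N M"
proof -
  interpret M: ring M using M by (simp add: k_algebra_def)
  interpret M: Module.module class_ring M using M by (simp add: k_algebra_def)
  have cr: "cring (class_ring :: 'a ring)" using M unfolding k_algebra_def Module.module_def by blast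
  have closed: "c \<odot>\<^bsub>M\<^esub> x \<in> carrier M" if "x \<in> carrier M" for c x
    using M.smult_closed[of c x] that by (simp add: class_ring_simps)
  have iso: "g \<in> ring_iso M N"
    using g by (auto simp: ring_iso_def bij_betw_def mult add one intro!: ring_hom_memI)
  have "ring N"
    using M.ring_iso_imp_img_ring[OF iso] by (simp add: zero)
  then interpret N: ring N .
  have img: "\<exists>x'\<in>carrier M. x = g x'" if "x \<in> carrier N" for x
    using g that by (auto simp: bij_betw_def)
  have gN: "g x \<in> carrier N" if "x \<in> carrier M" for x
    using g that by (auto simp: bij_betw_def)
  have "Module.module class_ring N"
  proof (rule Module.module.intro, rule cr, rule N.is_abelian_group, unfold_locales)
    fix a b :: 'a and x y
    show "a \<odot>\<^bsub>N\<^esub> x \<in> carrier N" if "x \<in> carrier N"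
      using img[OF that] gN closed by (auto simp flip: smult)
    show "(a \<oplus>\<^bsub>class_ring\<^esub> b) \<odot>\<^bsub>N\<^esub> x = a \<odot>\<^bsub>N\<^esub> x \<oplus>\<^bsub>N\<^esub> b \<odot>\<^bsub>N\<^esub> x" if "x \<in> carrier N"
      using img[OF that] closed M.smult_l_distr[of a b]
      by (auto simp: class_ring_simps simp flip: smult add)
    show "a \<odot>\<^bsub>N\<^esub> (x \<oplus>\<^bsub>N\<^esub> y) = a \<odot>\<^bsub>N\<^esub> x \<oplus>\<^bsub>N\<^esub> a \<odot>\<^bsub>N\<^esub> y" if "x \<in> carrier N" "y \<in> carrier N"
      using img[OF that(1)] img[OF that(2)] closed M.smult_r_distr[of a]
      by (auto simp: class_ring_simps simp flip: smult add)
    show "(a \<otimes>\<^bsub>class_ring\<^esub> b) \<odot>\<^bsub>N\<^esub> x = a \<odot>\<^bsub>N\<^esub> (b \<odot>\<^bsub>N\<^esub> x)" if "x \<in> carrier N"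
      using img[OF that] closed M.smult_assoc1[of a b]
      by (auto simp: class_ring_simps simp flip: smult)
    show "\<one>\<^bsub>class_ring\<^esub> \<odot>\<^bsub>N\<^esub> x = x" if "x \<in> carrier N"
      using img[OF that] M.smult_one by (auto simp: class_ring_simps simp flip: smult)
  qed
  moreover have "(c \<odot>\<^bsub>N\<^esub> x) \<otimes>\<^bsub>N\<^esub> y = c \<odot>\<^bsub>N\<^esub> (x \<otimes>\<^bsub>N\<^esub> y) \<and> x \<otimes>\<^bsub>N\<^esub> (c \<odot>\<^bsub>N\<^esub> y) = c \<odot>\<^bsub>N\<^esub> (x \<otimes>\<^bsub>N\<^esub> y)"
    if "x \<in> carrier N" "y \<in> carrier N" for c x y
    using img[OF that(1)] img[OF that(2)] closed M
    by (auto simp: k_algebra_def simp flip: smult mult)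
  ultimately have N: "k_algebra N"
    using \<open>ring N\<close> by (simp add: k_algebra_def)
  show "k_algebra_isomorphic M N"
    using M N iso smult by (auto simp: k_algebra_isomorphic_def k_algebra_iso_def)
  have "inv_into (carrier M) g \<in> ring_iso N M"
    by (rule ring_iso_set_sym[OF M.ring_axioms iso])
  moreover have "inv_into (carrier M) g (c \<odot>\<^bsub>N\<^esub> x) = c \<odot>\<^bsub>M\<^esub> inv_into (carrier M) g x"
    if "x \<in> carrier N" for c x
    using img[OF that] g closed by (auto simp: bij_betw_def simp flip: smult)
  ultimately show "k_algebra_isomorphic N M"
    using M N by (auto simp: k_algebra_isomorphic_def k_algebra_iso_def)
qed

lemma k_algebra_subalgebra:
  fixes M :: "('a::field, 'm) module"
  assumes M: "k_algebra M" and S: "k_subalgebra S M"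
  shows "k_algebra (M \<lparr>carrier := S\<rparr>)"
proof -
  interpret M: ring M using M by (simp add: k_algebra_def)
  interpret M: Module.module class_ring M using M by (simp add: k_algebra_def)
  have cr: "cring (class_ring :: 'a ring)" using M unfolding k_algebra_def Module.module_def by blast
  have sub: "subring S M" using S by (simp add: k_subalgebra_def)
  have SM: "x \<in> carrier M" if "x \<in> S" for x using subringE(1)[OF sub] that by auto
  have "ring (M \<lparr>carrier := S\<rparr>)" by (rule M.subring_is_ring[OF sub])
  then interpret N: ring "M \<lparr>carrier := S\<rparr>" .
  have "Module.module class_ring (M \<lparr>carrier := S\<rparr>)"
  proof (rule Module.module.intro, rule cr, rule N.is_abelian_group, unfold_locales)
  qed (use S M.smult_l_distr M.smult_r_distr M.smult_assoc1 M.smult_one SM in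
        \<open>auto simp: k_subalgebra_def class_ring_simps\<close>)
  then show ?thesis
    using M N.ring_axioms SM by (auto simp: k_algebra_def)
qed

lemma k_algebra_module_mat: "k_algebra (module_mat TYPE('k::field) d d)"
proof -
  have "ring (module_mat TYPE('k) d d)"
    by (unfold_locales, insert add_inv_exists_mat, auto simp: module_mat_def algebra_simps Units_def)
  moreover have "Module.module class_ring (module_mat TYPE('k) d d)"
    using matrix_vs[where 'a = 'k] unfolding vectorspace_def by blast
  ultimately show ?thesis
    by (auto simp: k_algebra_def module_mat_simps smult_carrier_mat mult_smult_distrib mult_smult_assoc_mat)
qed

section \<open>The block algebras as stabilisers of a line\<close>

text \<open>The vertex \<open>i\<close> owns the indices \<open>i - 1\<close> and \<open>n + (i - 1)\<close>, one in each half.\<close>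

definition vertex :: "nat \<Rightarrow> nat \<Rightarrow> nat" where
  "vertex n s = s mod n + 1"

text \<open>Let \<open>w\<close> be the vector of length \<open>2n\<close> with upper half \<open>0\<close> and lower half \<open>1\<close>. This is the coordinate \<open>t\<close>
  of \<open>Mw\<close>.\<close>

definition right_sum :: "nat \<Rightarrow> 'k::field mat \<Rightarrow> nat \<Rightarrow> 'k" where
  "right_sum n M t = (\<Sum>k<n. M $$ (t, n + k))"

lemma vertex_simps:
  "s < n \<Longrightarrow> vertex n s = s + 1"
  "s < n \<Longrightarrow> vertex n (n + s) = s + 1"
  "k \<in> {1..n} \<Longrightarrow> vertex n (k - 1) = k"
  "k \<in> {1..n} \<Longrightarrow> vertex n (n + (k - 1)) = k"
proof -
  show *: "s < n \<Longrightarrow> vertex n s = s + 1" "s < n \<Longrightarrow> vertex n (n + s) = s + 1" for s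
    by (simp_all add: vertex_def)
  show "k \<in> {1..n} \<Longrightarrow> vertex n (k - 1) = k" "k \<in> {1..n} \<Longrightarrow> vertex n (n + (k - 1)) = k"
    using *[of "k - 1"] by auto
qed

lemma vertex_in_range: "s < 2 * n \<Longrightarrow> vertex n s \<in> {1..n}"
  by (cases n) (auto simp: vertex_def Suc_le_eq)

lemma index_cases:
  assumes "s < 2 * n"
  obtains "s = vertex n s - 1" | "s = n + (vertex n s - 1)"
proof (cases "s < n")
  case False
  then have "vertex n s = s - n + 1" using assms vertex_simps(2)[of "s - n" n] by auto
  then show ?thesis using that False by auto
qed (use that vertex_simps(1) in auto)

lemma sum_doubled: "(\<Sum>s<2 * n. f s) = (\<Sum>s<n. f s) + (\<Sum>s<n. f (n + s :: nat) :: 'a::comm_monoid_add)"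
proof -
  have "(\<Sum>s<2 * n. f s) = (\<Sum>s\<in>{..<n} \<union> {n..<2 * n}. f s)"
    by (rule sum.cong) auto
  also have "\<dots> = (\<Sum>s<n. f s) + (\<Sum>s\<in>{n..<2 * n}. f s)"
    by (rule sum.union_disjoint) auto
  also have "(\<Sum>s\<in>{n..<2 * n}. f s) = (\<Sum>s<n. f (n + s))"
    using sum.shift_bounds_nat_ivl[of f 0 n n] by (simp add: lessThan_atLeast0 mult_2 add.commute)
  finally show ?thesis .
qed

lemma sum_vertices:
  fixes f :: "nat \<Rightarrow> 'a::comm_monoid_add"
  shows "(\<Sum>k\<in>{1..n}. f (k - 1)) = (\<Sum>s<n. f s)"
  by (rule sum.reindex_bij_witness[of _ Suc "\<lambda>k. k - 1"]) auto

lemma sum_indices: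
  fixes f :: "nat \<Rightarrow> 'a::comm_monoid_add"
  shows "(\<Sum>s<2 * n. f s) = (\<Sum>k\<in>{1..n}. f (k - 1) + f (n + (k - 1)))"
  by (simp only: sum_doubled sum_vertices[of f] sum_vertices[of "\<lambda>s. f (n + s)"] sum.distrib)

lemma incidence_alg_iff:
  "B \<in> incidence_alg n r \<longleftrightarrow> B \<in> carrier_mat n n \<and>
     (\<forall>t<n. \<forall>s<n. B $$ (t, s) \<noteq> 0 \<longrightarrow> (s + 1, t + 1) \<in> r)"
proof -
  have "(\<forall>i\<in>{1..n}. P i) \<longleftrightarrow> (\<forall>s<n. P (s + 1))" for P
    by (simp only: image_Suc_lessThan[symmetric]) auto
  then show ?thesis by (auto simp: incidence_alg_def)
qed

lemma mult_ones_vec_iff: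
  assumes "B \<in> carrier_mat n n"
  shows "B *\<^sub>v ones_vec n = c \<cdot>\<^sub>v ones_vec n \<longleftrightarrow> (\<forall>t<n. (\<Sum>k<n. B $$ (t, k)) = c)"
proof -
  have "(B *\<^sub>v ones_vec n) $ t = (\<Sum>k<n. B $$ (t, k))" if "t < n" for t
    using assms that by (simp add: ones_vec_def scalar_prod_def lessThan_atLeast0)
  then show ?thesis
    using assms by (auto simp: vec_eq_iff ones_vec_def)
qed

text \<open>The halves of \<open>Mw\<close> are \<open>M\<^sub>1\<^sub>2\<^bold>1\<close> and \<open>M\<^sub>2\<^sub>2\<^bold>1\<close>, so the conditions on the two right blocks amount to
  \<open>Mw \<in> Kw\<close>. In this form, closure under products is evident.\<close>

lemma mem_large_block_alg_iff:
  "M \<in> large_block_alg n r \<longleftrightarrow> M \<in> carrier_mat (2 * n) (2 * n) \<and>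
     (\<forall>t<2 * n. \<forall>s<2 * n. M $$ (t, s) \<noteq> 0 \<longrightarrow> (vertex n s, vertex n t) \<in> r) \<and>
     (\<exists>c. \<forall>t<2 * n. right_sum n M t = (if t < n then 0 else c))" (is "_ \<longleftrightarrow> ?R M")
proof -
  have dbl: "(\<forall>t<2 * n. P t) \<longleftrightarrow> (\<forall>t<n. P t) \<and> (\<forall>t<n. P (n + t))" for P
  proof -
    have "P t" if "\<forall>t<n. P t" "\<forall>t<n. P (n + t)" "t < 2 * n" for t
    proof (cases "t < n")
      case False
      then have "P (n + (t - n))" using that(2,3) by (intro that(2)[rule_format]) auto
      then show ?thesis using False by simp
    qed (use that in auto)
    then show ?thesis by auto
  qed
  have zero: "B *\<^sub>v ones_vec n = 0\<^sub>v n \<longleftrightarrow> (\<forall>t<n. (\<Sum>k<n. B $$ (t, k)) = 0)"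
    if "B \<in> carrier_mat n n" for B :: "'a mat"
  proof -
    have "(0 :: 'a) \<cdot>\<^sub>v ones_vec n = 0\<^sub>v n" by (intro eq_vecI) (auto simp: ones_vec_def)
    then show ?thesis using mult_ones_vec_iff[OF that, of 0] by simp
  qed
  have iff: "?R (four_block_mat B11 B12 B21 B22) \<longleftrightarrow>
      B11 \<in> incidence_alg n r \<and> B12 \<in> row_centralized n r \<and>
      B21 \<in> incidence_alg n r \<and> B22 \<in> row_balanced n r"
    if "B11 \<in> carrier_mat n n" "B12 \<in> carrier_mat n n"
       "B21 \<in> carrier_mat n n" "B22 \<in> carrier_mat n n" for B11 B12 B21 B22 :: "'a mat"
  proof -
    have c: "four_block_mat B11 B12 B21 B22 \<in> carrier_mat (2 * n) (2 * n)"
      using four_block_carrier_mat[OF that(1,4)] by (simp add: mult_2)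
    show ?thesis
      using that c
      by (auto simp: dbl incidence_alg_iff row_centralized_def row_balanced_def zero mult_ones_vec_iff
          right_sum_def vertex_simps)
  qed
  show ?thesis
  proof
    assume "M \<in> large_block_alg n r"
    then obtain B11 B12 B21 B22 where M: "M = four_block_mat B11 B12 B21 B22" and
      B: "B11 \<in> incidence_alg n r" "B12 \<in> row_centralized n r"
       "B21 \<in> incidence_alg n r" "B22 \<in> row_balanced n r"
      by (auto simp: large_block_alg_def block_matrices_def)
    then show "?R M"
      using iff[of B11 B12 B21 B22]
      by (auto simp: incidence_alg_def row_centralized_def row_balanced_def)
  next
    assume R: "?R M"
    obtain B11 B12 B21 B22 where split: "split_block M n n = (B11, B12, B21, B22)"
      by (cases "split_block M n n") auto
    have "dim_row M = n + n" "dim_col M = n + n" using R by auto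
    note split = split_block[OF split this]
    show "M \<in> large_block_alg n r"
      using iff[OF split(1-4)] R unfolding split(5)
      by (auto simp: large_block_alg_def block_matrices_def)
  qed
qed

text \<open>The eigenvalue can be read off in row \<open>n\<close>, the first row of the lower half.\<close>

lemma large_block_algD:
  assumes "M \<in> large_block_alg n r"
  shows "M \<in> carrier_mat (2 * n) (2 * n)"
    and "\<And>t s. t < 2 * n \<Longrightarrow> s < 2 * n \<Longrightarrow> M $$ (t, s) \<noteq> 0 \<Longrightarrow> (vertex n s, vertex n t) \<in> r"
    and "\<And>t. t < 2 * n \<Longrightarrow> right_sum n M t = (if t < n then 0 else right_sum n M n)"
proof -
  obtain c where c: "\<And>t. t < 2 * n \<Longrightarrow> right_sum n M t = (if t < n then 0 else c)"
    using assms by (auto simp: mem_large_block_alg_iff)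
  show "right_sum n M t = (if t < n then 0 else right_sum n M n)" if "t < 2 * n" for t
    using c[OF that] c[of n] that by (cases "n = 0") auto
qed (use assms in \<open>auto simp: mem_large_block_alg_iff\<close>)

lemma index_mat_mult_sum:
  assumes "N \<in> carrier_mat d d" "M \<in> carrier_mat d d" "t < d" "s < d"
  shows "(N * M) $$ (t, s) = (\<Sum>u<d. N $$ (t, u) * M $$ (u, s) :: 'k::field)"
  using assms by (simp add: scalar_prod_def lessThan_atLeast0)

lemma right_sum_mult:
  assumes N: "N \<in> carrier_mat (2 * n) (2 * n)" and M: "M \<in> large_block_alg n r" and t: "t < 2 * n"
  shows "right_sum n (N * M) t = right_sum n N t * right_sum n M n"
proof -
  note D = large_block_algD[OF M]
  have "right_sum n (N * M) t = (\<Sum>k<n. \<Sum>u<2 * n. N $$ (t, u) * M $$ (u, n + k))"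
    unfolding right_sum_def
    by (intro sum.cong refl index_mat_mult_sum[OF N D(1) t]) auto
  also have "\<dots> = (\<Sum>u<2 * n. N $$ (t, u) * right_sum n M u)"
    by (subst sum.swap) (simp add: right_sum_def sum_distrib_left)
  also have "\<dots> = (\<Sum>u<2 * n. N $$ (t, u) * (if u < n then 0 else right_sum n M n))"
    by (intro sum.cong refl) (use D(3) in auto)
  also have "\<dots> = right_sum n N t * right_sum n M n"
    by (simp add: sum_doubled right_sum_def sum_distrib_right)
  finally show ?thesis .
qed

lemma large_block_alg_mult:
  assumes "trans r" and N: "N \<in> large_block_alg n r" and M: "M \<in> large_block_alg n r"
  shows "N * M \<in> large_block_alg n r"
proof -
  note DN = large_block_algD[OF N] and DM = large_block_algD[OF M]
  have "(vertex n s, vertex n t) \<in> r" if st: "t < 2 * n" "s < 2 * n" "(N * M) $$ (t, s) \<noteq> 0" for s t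
  proof -
    have "(\<Sum>u<2 * n. N $$ (t, u) * M $$ (u, s)) \<noteq> 0"
      using st by (simp add: index_mat_mult_sum[OF DN(1) DM(1)])
    then obtain u where u: "u < 2 * n" "N $$ (t, u) * M $$ (u, s) \<noteq> 0"
      by (meson lessThan_iff sum.neutral)
    then have "(vertex n s, vertex n u) \<in> r" "(vertex n u, vertex n t) \<in> r"
      using DM(2) DN(2) st by auto
    then show ?thesis using \<open>trans r\<close> by (meson transD)
  qed
  moreover have "right_sum n (N * M) t = (if t < n then 0 else right_sum n N n * right_sum n M n)"
    if "t < 2 * n" for t
    using right_sum_mult[OF DN(1) M that] DN(3)[OF that] by simp
  ultimately show ?thesis
    using DN(1) DM(1) by (auto simp: mem_large_block_alg_iff)
qed

lemma large_block_alg_linear: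
  assumes N: "N \<in> large_block_alg n r" and M: "M \<in> large_block_alg n r"
  shows "N + M \<in> large_block_alg n r" "c \<cdot>\<^sub>m M \<in> large_block_alg n r"
proof -
  note DN = large_block_algD[OF N] and DM = large_block_algD[OF M]
  have [simp]: "dim_row M = 2 * n" "dim_col M = 2 * n" "dim_row N = 2 * n" "dim_col N = 2 * n"
    using DN(1) DM(1) by auto
  have "right_sum n (N + M) t = right_sum n N t + right_sum n M t"
    "right_sum n (c \<cdot>\<^sub>m M) t = c * right_sum n M t" if "t < 2 * n" for t
    using that by (simp_all add: right_sum_def sum.distrib sum_distrib_left)
  then have 1: "right_sum n (N + M) t = (if t < n then 0 else right_sum n N n + right_sum n M n)"
    "right_sum n (c \<cdot>\<^sub>m M) t = (if t < n then 0 else c * right_sum n M n)" if "t < 2 * n" for t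
    using that DN(3)[OF that] DM(3)[OF that] by simp_all
  have 2: "(vertex n s, vertex n t) \<in> r" if "t < 2 * n" "s < 2 * n" "(N + M) $$ (t, s) \<noteq> 0" for s t
    using that DN(2)[of t s] DM(2)[of t s] by (cases "N $$ (t, s) = 0") auto
  have 3: "(vertex n s, vertex n t) \<in> r" if "t < 2 * n" "s < 2 * n" "(c \<cdot>\<^sub>m M) $$ (t, s) \<noteq> 0" for s t
    using that DM(2)[of t s] by auto
  show "N + M \<in> large_block_alg n r" "c \<cdot>\<^sub>m M \<in> large_block_alg n r"
    using DN(1) DM(1) 1 2 3 by (auto simp: mem_large_block_alg_iff)
qed

lemma one_mem_large_block_alg:
  assumes "\<And>i. i \<in> {1..n} \<Longrightarrow> (i, i) \<in> r"
  shows "1\<^sub>m (2 * n) \<in> (large_block_alg n r :: 'k::field mat set)"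
proof -
  have "right_sum n (1\<^sub>m (2 * n)) t = (if t < n then 0 else 1 :: 'k)" if "t < 2 * n" for t
  proof -
    have "right_sum n (1\<^sub>m (2 * n)) t = (\<Sum>k<n. if k = t - n \<and> n \<le> t then 1 else 0 :: 'k)"
      unfolding right_sum_def using that by (intro sum.cong) auto
    then show ?thesis using that by (cases "t < n") (simp_all add: sum.delta')
  qed
  then show ?thesis
    using assms vertex_in_range by (auto simp: mem_large_block_alg_iff split: if_splits)
qed

lemma k_subalgebra_large_block_alg:
  assumes "trans r" "\<And>i. i \<in> {1..n} \<Longrightarrow> (i, i) \<in> r"
  shows "k_subalgebra (large_block_alg n r) (module_mat TYPE('k::field) (2 * n) (2 * n))"
proof -
  let ?R = "module_mat TYPE('k) (2 * n) (2 * n)"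
  interpret R: ring ?R
    using k_algebra_module_mat by (auto simp: k_algebra_def)
  have uminus: "\<ominus>\<^bsub>?R\<^esub> M = (- 1) \<cdot>\<^sub>m M" if "M \<in> large_block_alg n r" for M
  proof (rule R.minus_equality)
    show "M \<in> carrier ?R" "- 1 \<cdot>\<^sub>m M \<in> carrier ?R"
      using large_block_algD(1)[OF that] by (auto simp: module_mat_simps)
    show "- 1 \<cdot>\<^sub>m M \<oplus>\<^bsub>?R\<^esub> M = \<zero>\<^bsub>?R\<^esub>"
      using large_block_algD(1)[OF that] by (auto simp: module_mat_simps intro!: eq_matI)
  qed
  have one: "1\<^sub>m (2 * n) \<in> (large_block_alg n r :: 'k mat set)"
    by (rule one_mem_large_block_alg) (rule assms(2))
  have "subring (large_block_alg n r) ?R"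
    by (rule R.subringI)
      (auto simp: uminus module_mat_simps large_block_algD(1) large_block_alg_linear
        large_block_alg_mult assms(1) one)
  then show ?thesis
    by (auto simp: k_subalgebra_def module_mat_simps large_block_alg_linear)
qed

lemma large_block_alg_mono:
  "r \<subseteq> r' \<Longrightarrow> large_block_alg n r \<subseteq> large_block_alg n r'"
  by (auto simp: mem_large_block_alg_iff) blast

text \<open>Incidence matrices of the equality order are diagonal, and then each row sum is the diagonal entry.\<close>

lemma small_block_alg_eq: "small_block_alg n = (large_block_alg n (Id_on {1..n}) :: 'k::field mat set)"
proof -
  let ?r = "Id_on {1..n}"
  have diag: "(incidence_alg n ?r :: 'k mat set) = diag_matrices n"
    by (auto simp: incidence_alg_iff diag_matrices_def diagonal_mat_def Id_on_iff) metis+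
  have row: "(\<Sum>k<n. B $$ (t, k)) = B $$ (t, t)" if "B \<in> diag_matrices n" "t < n" for B :: "'k mat" and t
  proof -
    have "(\<Sum>k<n. B $$ (t, k)) = (\<Sum>k\<in>{t}. B $$ (t, k))"
      using that by (intro sum.mono_neutral_right) (auto simp: diag_matrices_def diagonal_mat_def, metis)
    then show ?thesis by simp
  qed
  have scalar: "(\<exists>c. \<forall>t<n. B $$ (t, t) = c) \<longleftrightarrow> B \<in> scalar_matrices n" if B: "B \<in> diag_matrices n" for B :: "'k mat"
  proof
    assume "\<exists>c. \<forall>t<n. B $$ (t, t) = c"
    then obtain c where "\<forall>t<n. B $$ (t, t) = c" ..
    then have "B = c \<cdot>\<^sub>m 1\<^sub>m n"
      using B by (intro eq_matI) (auto simp: diag_matrices_def diagonal_mat_def)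
    then show "B \<in> scalar_matrices n" by (auto simp: scalar_matrices_def)
  qed (auto simp: scalar_matrices_def)
  have zero: "(\<forall>t<n. B $$ (t, t) = 0) \<longleftrightarrow> B = 0\<^sub>m n n" if B: "B \<in> diag_matrices n" for B :: "'k mat"
    using B by (auto simp: diag_matrices_def diagonal_mat_def intro!: eq_matI) metis
  have sub: "scalar_matrices n \<subseteq> (diag_matrices n :: 'k mat set)" "0\<^sub>m n n \<in> (diag_matrices n :: 'k mat set)"
    by (auto simp: scalar_matrices_def diag_matrices_def diagonal_mat_def)
  have ones: "B *\<^sub>v ones_vec n = c \<cdot>\<^sub>v ones_vec n \<longleftrightarrow> (\<forall>t<n. B $$ (t, t) = c)"
    if B: "B \<in> diag_matrices n" for B :: "'k mat" and c
    using mult_ones_vec_iff[of B n c] row[OF B] B by (auto simp: diag_matrices_def)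
  have zero_vec: "0\<^sub>v n = (0 :: 'k) \<cdot>\<^sub>v ones_vec n"
    by (intro eq_vecI) (auto simp: ones_vec_def)
  have "B \<in> row_centralized n ?r \<longleftrightarrow> B \<in> {0\<^sub>m n n}" for B :: "'k mat"
    unfolding row_centralized_def diag zero_vec using zero[of B] ones[of B] sub by auto
  moreover have "B \<in> row_balanced n ?r \<longleftrightarrow> B \<in> scalar_matrices n" for B :: "'k mat"
    unfolding row_balanced_def diag using scalar[of B] ones[of B] sub by auto
  ultimately show ?thesis
    unfolding small_block_alg_def large_block_alg_def diag by (metis subsetI subset_antisym)
qed

section \<open>Paths of small degree\<close>

lemma pmult_uminus: "x \<star> (- y) = - (x \<star> y)" "(- x) \<star> y = - (x \<star> y)"
  using pmult_add_right[of x y "- y"] pmult_add_left[of x "- x" y]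
  by (simp_all add: eq_neg_iff_add_eq_0 add.commute)

lemma pscale_sum_left: "(\<Sum>s\<in>S. f s) \<cdot>\<^sub>p x = (\<Sum>s\<in>S. f s \<cdot>\<^sub>p x)"
  by (induction S rule: infinite_finite_induct) (simp_all add: pscale_add)

lemma path_alg_degree_closed:
  "0 \<in> path_alg_degree n r d"
  "x \<in> path_alg_degree n r d \<Longrightarrow> y \<in> path_alg_degree n r d \<Longrightarrow> x + y \<in> path_alg_degree n r d"
  "x \<in> path_alg_degree n r d \<Longrightarrow> c \<cdot>\<^sub>p x \<in> path_alg_degree n r d"
  "x \<in> path_alg_degree n r d \<Longrightarrow> - x \<in> path_alg_degree n r d"
  "is_path n r p \<Longrightarrow> path_degree p = d \<Longrightarrow> basis_path p \<in> path_alg_degree n r d"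
  using Poly_Mapping.keys_add[of x y]
  by (auto simp: path_alg_degree_def path_alg_def in_keys_iff lookup_add split: if_splits)

lemma path_alg_degree_sum:
  "(\<And>s. s \<in> S \<Longrightarrow> f s \<in> path_alg_degree n r d) \<Longrightarrow> sum f S \<in> path_alg_degree n r d"
  by (induction S rule: infinite_finite_induct) (auto intro: path_alg_degree_closed)

text \<open>Linear statements about homogeneous elements need to be checked on paths only.\<close>

lemma path_alg_degree_induct [consumes 1, case_names zero add scale basis]:
  assumes "x \<in> path_alg_degree n r d"
    and "P 0" "\<And>x y. P x \<Longrightarrow> P y \<Longrightarrow> P (x + y)" "\<And>c x. P x \<Longrightarrow> P (c \<cdot>\<^sub>p x)"
    and "\<And>p. is_path n r p \<Longrightarrow> path_degree p = d \<Longrightarrow> P (basis_path p)"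
  shows "P x"
proof -
  have "P (\<Sum>p\<in>S. Poly_Mapping.lookup x p \<cdot>\<^sub>p basis_path p)" if "S \<subseteq> Poly_Mapping.keys x" for S
    using finite_subset[OF that finite_keys] that
  proof (induction S rule: finite_induct)
    case (insert p S)
    then have "is_path n r p" "path_degree p = d"
      using assms(1) by (auto simp: path_alg_degree_def path_alg_def)
    with insert show ?case by (simp add: assms)
  qed (simp add: assms)
  from this[of "Poly_Mapping.keys x"] show ?thesis
    by (simp flip: basis_expansion)
qed

lemma is_path_comp:
  "is_path n r p \<Longrightarrow> is_path n r q \<Longrightarrow> path_source p = path_target q \<Longrightarrow> is_path n r (path_comp p q)"
proof (cases p; cases q)
  fix as s bs t
  assume pq: "p = (as, s)" "q = (bs, t)" and q: "is_path n r q" and s: "path_source p = path_target q"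
  have "is_path n r (as, s) \<Longrightarrow> is_path n r (as @ bs, t)"
  proof (induction as)
    case (Cons a as)
    then show ?case using s pq by (cases as) auto
  qed (use q pq in auto)
  then show "is_path n r p \<Longrightarrow> is_path n r (path_comp p q)" using pq by simp
qed

lemma path_degree_comp: "path_degree (path_comp p q) = path_degree p + path_degree q"
  by (cases p; cases q) simp

lemma path_alg_degree_mult:
  assumes "x \<in> path_alg_degree n r d" "y \<in> path_alg_degree n r d'"
  shows "x \<star> y \<in> path_alg_degree n r (d + d')"
  using assms(1)
proof (induction rule: path_alg_degree_induct)
  case (basis p)
  from assms(2) show ?case
  proof (induction rule: path_alg_degree_induct)
    case (basis q)
    then show ?case
      using \<open>is_path n r p\<close> \<open>path_degree p = d\<close>
      by (auto simp: pmult_basis path_degree_comp is_path_comp intro!: path_alg_degree_closed)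
  qed (auto simp: pmult_add_right pmult_scale_right intro: path_alg_degree_closed)
qed (auto simp: pmult_add_left pmult_scale_left intro: path_alg_degree_closed)

abbreviation vtx :: "nat \<Rightarrow> qpath" where "vtx i \<equiv> ([], i)"
abbreviation alpha :: "nat \<Rightarrow> qpath" where "alpha i \<equiv> ([Alpha i], i)"
abbreviation vee :: "nat \<Rightarrow> nat \<Rightarrow> qpath" where "vee i j \<equiv> ([Vee i j], j)"
abbreviation alpha_vee :: "nat \<Rightarrow> nat \<Rightarrow> qpath" where "alpha_vee i j \<equiv> ([Alpha i, Vee i j], j)"

lemma diff_path_small:
  "diff_path r (vtx i) = 0"
  "diff_path r (alpha i) = - (\<Sum>h\<in>{h. (h, i) \<in> r \<and> h \<noteq> i}. basis_path (alpha_vee h i))"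
  "diff_path r (vee i j) =
     (\<Sum>k\<in>{k. (i, k) \<in> r \<and> i \<noteq> k \<and> (k, j) \<in> r \<and> k \<noteq> j}. basis_path ([Vee i k, Vee k j], j))"
  "diff_path r (alpha_vee i j) =
     - (\<Sum>h\<in>{h. (h, i) \<in> r \<and> h \<noteq> i}. basis_path ([Alpha h, Vee h i, Vee i j], j))
     + (\<Sum>k\<in>{k. (i, k) \<in> r \<and> i \<noteq> k \<and> (k, j) \<in> r \<and> k \<noteq> j}. basis_path ([Alpha i, Vee i k, Vee k j], j))"
  by (simp_all add: pmult_uminus pmult_sum_left pmult_sum_right pmult_basis)

locale finite_poset =
  fixes n :: nat and r :: "nat rel"
  assumes pos: "n \<ge> 1" and range: "r \<subseteq> {1..n} \<times> {1..n}"
    and reflex: "\<And>i. i \<in> {1..n} \<Longrightarrow> (i, i) \<in> r"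
    and trans: "trans r" and antisym: "antisym r"
begin

text \<open>No arrow starts at the vertex \<open>0\<close> where \<open>\<alpha>\<^sub>i\<close> ends, so \<open>\<alpha>\<^sub>i\<close> can only be the leftmost arrow of a path.\<close>

lemma is_path_degree_0:
  "is_path n r p \<and> path_degree p = 0 \<longleftrightarrow> p \<in> vtx ` {0..n} \<union> alpha ` {1..n}"
proof -
  obtain as s where p: "p = (as, s)" by (cases p)
  have "as = [] \<or> (\<exists>i. as = [Alpha i])" if "is_path n r (as, s)" "path_degree (as, s) = 0"
  proof (cases as)
    case (Cons a bs)
    show ?thesis
    proof (cases bs)
      case (Cons b cs)
      then show ?thesis using that \<open>as = a # bs\<close>
        by (cases a; cases b) (auto simp: quiver_arrows_def)
    qed (use that Cons in \<open>cases a; auto\<close>)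
  qed simp
  then show ?thesis unfolding p
    by (auto simp: quiver_arrows_def)
qed

lemma is_path_degree_1:
  "is_path n r p \<and> path_degree p = 1 \<longleftrightarrow>
     (\<exists>i j. (i, j) \<in> r \<and> i \<noteq> j \<and> p \<in> {vee i j, alpha_vee i j})"
proof -
  have r: "i \<noteq> 0 \<and> j \<noteq> 0 \<and> i \<le> n \<and> j \<le> n" if "(i, j) \<in> r" for i j using range that by auto
  have vee: "\<exists>i j. (i, j) \<in> r \<and> i \<noteq> j \<and> (Vee h k # bs, s) = vee i j"
    if "is_path n r (Vee h k # bs, s)" "path_degree (Vee h k # bs, s) = 1" for h k bs s
  proof -
    have "is_path n r (bs, s)" "path_degree (bs, s) = 0" "k = path_target (bs, s)" "(h, k) \<in> r" "h \<noteq> k"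
      using that by (auto simp: quiver_arrows_def)
    then show ?thesis using is_path_degree_0[of "(bs, s)"] r[of h k] by auto
  qed
  obtain as s where p: "p = (as, s)" by (cases p)
  have "\<exists>i j. (i, j) \<in> r \<and> i \<noteq> j \<and> (as, s) \<in> {vee i j, alpha_vee i j}"
    if *: "is_path n r (as, s)" "path_degree (as, s) = 1"
  proof (cases as)
    case (Cons a bs)
    show ?thesis
    proof (cases a)
      case (Vee h k)
      then show ?thesis using vee[of h k bs s] * Cons by auto
    next
      case (Alpha i)
      have b: "is_path n r (bs, s)" "path_degree (bs, s) = 1" "path_target (bs, s) = i" "i \<noteq> 0"
        using * Cons Alpha by (auto simp: quiver_arrows_def)
      then obtain b cs where bs: "bs = b # cs" by (cases bs) auto
      with b obtain k where "b = Vee i k" by (cases b) auto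
      with b bs vee[of i k cs s] show ?thesis using Cons Alpha by auto
    qed
  qed (use * in simp)
  moreover have "is_path n r p \<and> path_degree p = 1"
    if "(i, j) \<in> r" "i \<noteq> j" "p \<in> {vee i j, alpha_vee i j}" for i j
    using that r[OF that(1)] by (auto simp: quiver_arrows_def)
  ultimately show ?thesis unfolding p by blast
qed

lemma bocs_A_induct [consumes 1, case_names zero add scale vtx alpha]:
  assumes "x \<in> bocs_A n r"
    and "P 0" "\<And>x y. P x \<Longrightarrow> P y \<Longrightarrow> P (x + y)" "\<And>c x. P x \<Longrightarrow> P (c \<cdot>\<^sub>p x)"
    and "\<And>i. i \<le> n \<Longrightarrow> P (basis_path (vtx i))"
    and "\<And>i. i \<in> {1..n} \<Longrightarrow> P (basis_path (alpha i))"
  shows "P x"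
  using assms(1)[unfolded bocs_A_def]
proof (induction rule: path_alg_degree_induct)
  case (basis p)
  then have "p \<in> vtx ` {0..n} \<union> alpha ` {1..n}"
    using is_path_degree_0[of p] by blast
  then show ?case using assms(5,6) by auto
qed (use assms in auto)

lemma bocs_V_induct [consumes 1, case_names zero add scale vee alpha_vee]:
  assumes "x \<in> bocs_V n r"
    and "P 0" "\<And>x y. P x \<Longrightarrow> P y \<Longrightarrow> P (x + y)" "\<And>c x. P x \<Longrightarrow> P (c \<cdot>\<^sub>p x)"
    and "\<And>i j. (i, j) \<in> r \<Longrightarrow> i \<noteq> j \<Longrightarrow> P (basis_path (vee i j))"
    and "\<And>i j. (i, j) \<in> r \<Longrightarrow> i \<noteq> j \<Longrightarrow> P (basis_path (alpha_vee i j))"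
  shows "P x"
  using assms(1)[unfolded bocs_V_def]
proof (induction rule: path_alg_degree_induct)
  case (basis p)
  then obtain i j where "(i, j) \<in> r" "i \<noteq> j" "p \<in> {vee i j, alpha_vee i j}"
    using is_path_degree_1[of p] by auto
  then show ?case using assms(5,6) by auto
qed (use assms in auto)

lemma basis_mem:
  "i \<le> n \<Longrightarrow> basis_path (vtx i) \<in> bocs_A n r"
  "i \<in> {1..n} \<Longrightarrow> basis_path (alpha i) \<in> bocs_A n r"
  "(i, j) \<in> r \<Longrightarrow> i \<noteq> j \<Longrightarrow> basis_path (vee i j) \<in> bocs_V n r"
  "(i, j) \<in> r \<Longrightarrow> i \<noteq> j \<Longrightarrow> basis_path (alpha_vee i j) \<in> bocs_V n r"
proof -
  show "i \<le> n \<Longrightarrow> basis_path (vtx i) \<in> bocs_A n r" "i \<in> {1..n} \<Longrightarrow> basis_path (alpha i) \<in> bocs_A n r"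
    unfolding bocs_A_def
    by (rule path_alg_degree_closed(5); auto simp: quiver_arrows_def)+
  show "(i, j) \<in> r \<Longrightarrow> i \<noteq> j \<Longrightarrow> basis_path (vee i j) \<in> bocs_V n r"
    "(i, j) \<in> r \<Longrightarrow> i \<noteq> j \<Longrightarrow> basis_path (alpha_vee i j) \<in> bocs_V n r"
    unfolding bocs_V_def
    by (rule path_alg_degree_closed(5); use is_path_degree_1 in \<open>auto simp del: is_path.simps path_degree.simps\<close>)+
qed

lemma bocs_closed:
  "0 \<in> bocs_A n r" "0 \<in> bocs_V n r"
  "x \<in> bocs_A n r \<Longrightarrow> y \<in> bocs_A n r \<Longrightarrow> x + y \<in> bocs_A n r"
  "v \<in> bocs_V n r \<Longrightarrow> w \<in> bocs_V n r \<Longrightarrow> v + w \<in> bocs_V n r"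
  "x \<in> bocs_A n r \<Longrightarrow> c \<cdot>\<^sub>p x \<in> bocs_A n r"
  "v \<in> bocs_V n r \<Longrightarrow> c \<cdot>\<^sub>p v \<in> bocs_V n r"
  "x \<in> bocs_A n r \<Longrightarrow> y \<in> bocs_A n r \<Longrightarrow> x \<star> y \<in> bocs_A n r"
  "x \<in> bocs_A n r \<Longrightarrow> v \<in> bocs_V n r \<Longrightarrow> x \<star> v \<in> bocs_V n r"
  "v \<in> bocs_V n r \<Longrightarrow> x \<in> bocs_A n r \<Longrightarrow> v \<star> x \<in> bocs_V n r"
  using path_alg_degree_mult[of x n r 0 y 0] path_alg_degree_mult[of x n r 0 v 1]
    path_alg_degree_mult[of v n r 1 x 0]
  by (auto simp: bocs_A_def bocs_V_def intro: path_alg_degree_closed)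

lemma path_one_mem: "path_one n \<in> bocs_A n r"
  unfolding path_one_def bocs_A_def
  by (rule path_alg_degree_sum) (use basis_mem(1) in \<open>auto simp: bocs_A_def\<close>)

lemma path_one_right:
  assumes "x \<in> path_alg_degree n r d"
  shows "x \<star> path_one n = x"
  using assms
proof (induction rule: path_alg_degree_induct)
  case (basis p)
  have "path_source p \<le> n"
  proof -
    obtain as s where p: "p = (as, s)" by (cases p)
    have "is_path n r (as, s) \<Longrightarrow> s \<le> n" by (induction as) auto
    then show ?thesis using basis p by simp
  qed
  then show ?case
    by (simp add: path_one_def pmult_sum_right path_source_basis_mult sum.delta del: path_source.simps)
qed (auto simp: pmult_add_left pmult_scale_left)

lemma path_one_left:
  assumes "x \<in> path_alg_degree n r d"
  shows "path_one n \<star> x = x"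
  using assms
proof (induction rule: path_alg_degree_induct)
  case (basis p)
  have "path_target p \<le> n"
    using basis(1) range by (cases p rule: path_target.cases) (auto simp: quiver_arrows_def)
  then show ?case
    by (simp add: path_one_def pmult_sum_left path_target_basis_mult sum.delta del: path_target.simps)
qed (auto simp: pmult_add_right pmult_scale_right)

lemma bocs_diff_A: "a \<in> bocs_A n r \<Longrightarrow> bocs_diff r a \<in> bocs_V n r"
proof (induction rule: bocs_A_induct)
  case (alpha i)
  show ?case
    unfolding bocs_diff_basis diff_path_small bocs_V_def
    by (intro path_alg_degree_closed(4) path_alg_degree_sum)
      (use basis_mem(4) in \<open>auto simp: bocs_V_def\<close>)
qed (auto simp: bocs_diff_linear bocs_closed)

lemma bocs_diff_V: "v \<in> bocs_V n r \<Longrightarrow> bocs_diff r v \<in> path_alg_degree n r 2"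
proof (induction rule: bocs_V_induct)
  case (vee i j)
  have *: "i \<in> {1..n}" "j \<in> {1..n}" using vee range by auto
  show ?case
    unfolding bocs_diff_basis diff_path_small
    by (intro path_alg_degree_sum path_alg_degree_closed) (use vee * in \<open>auto simp: quiver_arrows_def\<close>)
next
  case (alpha_vee i j)
  have *: "i \<in> {1..n}" "j \<in> {1..n}" using alpha_vee range by auto
  have **: "h \<in> {1..n} \<and> k \<in> {1..n}" if "(h, k) \<in> r" for h k using that range by auto
  show ?case
    unfolding bocs_diff_basis diff_path_small
    by (intro path_alg_degree_sum path_alg_degree_closed)
      (use alpha_vee * in \<open>auto simp: quiver_arrows_def dest!: **\<close>)
qed (auto simp: bocs_diff_linear path_alg_degree_closed)

end

section \<open>Coordinates of right-module maps\<close>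

text \<open>The element of \<open>Ae\<^sub>j\<close> whose coordinates on \<open>e\<^sub>j\<close> and \<open>\<alpha>\<^sub>j\<close> stand in column \<open>s\<close>.\<close>

definition column :: "nat \<Rightarrow> 'k::field mat \<Rightarrow> nat \<Rightarrow> nat \<Rightarrow> (qpath \<Rightarrow>\<^sub>0 'k)" where
  "column n M j s = M $$ (j - 1, s) \<cdot>\<^sub>p basis_path (vtx j) + M $$ (n + (j - 1), s) \<cdot>\<^sub>p basis_path (alpha j)"

text \<open>The values on the basis of \<open>V\<close>; the last equation is a default off that basis.\<close>

fun gen_image :: "nat \<Rightarrow> 'k::field mat \<Rightarrow> qpath \<Rightarrow> (qpath \<Rightarrow>\<^sub>0 'k)" where
  "gen_image n M ([Vee i j], s) = column n M j (i - 1)"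
| "gen_image n M ([Alpha h, Vee i j], s) = column n M j (n + (i - 1))"
| "gen_image n M _ = 0"

text \<open>The value at \<open>\<omega>\<close>. Its component in \<open>Ae\<^sub>0\<close> is the eigenvalue belonging to \<open>w\<close>.\<close>

definition omega_image :: "nat \<Rightarrow> 'k::field mat \<Rightarrow> (qpath \<Rightarrow>\<^sub>0 'k)" where
  "omega_image n M = right_sum n M n \<cdot>\<^sub>p basis_path (vtx 0) + (\<Sum>j\<in>{1..n}. column n M j (j - 1))"

fun matrix_map :: "nat \<Rightarrow> 'k::field mat \<Rightarrow> 'k bocs_elt \<Rightarrow> (qpath \<Rightarrow>\<^sub>0 'k)" where
  "matrix_map n M (b, v) = omega_image n M \<star> b + plinear (gen_image n M) v"

lemma column_mult_basis:
  assumes "j \<noteq> 0"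
  shows "column n M j s \<star> basis_path (vtx k) = (if j = k then column n M j s else 0)"
    "column n M j s \<star> basis_path (alpha k) = 0"
    "column n M j s \<star> basis_path (vee i k) = (if j = i then
       M $$ (j - 1, s) \<cdot>\<^sub>p basis_path (vee i k) + M $$ (n + (j - 1), s) \<cdot>\<^sub>p basis_path (alpha_vee i k) else 0)"
    "column n M j s \<star> basis_path (alpha_vee i k) = 0"
  using assms by (simp_all add: column_def pmult_add_left pmult_scale_left pmult_basis)

lemma omega_image_mult_basis:
  "omega_image n M \<star> basis_path (vtx 0) = right_sum n M n \<cdot>\<^sub>p basis_path (vtx 0)"
  "j \<in> {1..n} \<Longrightarrow> omega_image n M \<star> basis_path (vtx j) = column n M j (j - 1)"
  "omega_image n M \<star> basis_path (alpha j) = right_sum n M n \<cdot>\<^sub>p basis_path (alpha j)"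
  "i \<in> {1..n} \<Longrightarrow> omega_image n M \<star> basis_path (vee i j) = column n M i (i - 1) \<star> basis_path (vee i j)"
  "omega_image n M \<star> basis_path (alpha_vee i j) = right_sum n M n \<cdot>\<^sub>p basis_path (alpha_vee i j)"
proof -
  have c: "(\<Sum>j\<in>{1..n}. column n M j (j - 1)) \<star> x = (\<Sum>j\<in>{1..n}. column n M j (j - 1) \<star> x)" for x
    by (simp add: pmult_sum_left)
  have 0: "(\<Sum>j\<in>{1..n}. column n M j (j - 1) \<star> x) = 0"
    if "\<And>j. j \<noteq> 0 \<Longrightarrow> column n M j (j - 1) \<star> x = 0" for x
    by (rule sum.neutral) (use that in auto)
  have 1: "(\<Sum>j\<in>{1..n}. column n M j (j - 1) \<star> x) = column n M i (i - 1) \<star> x"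
    if "i \<in> {1..n}" "\<And>j. j \<noteq> 0 \<Longrightarrow> j \<noteq> i \<Longrightarrow> column n M j (j - 1) \<star> x = 0" for x i
  proof -
    have "(\<Sum>j\<in>{1..n}. column n M j (j - 1) \<star> x) = (\<Sum>j\<in>{i}. column n M j (j - 1) \<star> x)"
      by (rule sum.mono_neutral_right) (use that in auto)
    then show ?thesis by simp
  qed
  show "omega_image n M \<star> basis_path (vtx 0) = right_sum n M n \<cdot>\<^sub>p basis_path (vtx 0)"
    unfolding omega_image_def pmult_add_left c pmult_scale_left
    by (subst 0) (simp_all add: column_mult_basis pmult_basis)
  show "omega_image n M \<star> basis_path (alpha j) = right_sum n M n \<cdot>\<^sub>p basis_path (alpha j)"
    unfolding omega_image_def pmult_add_left c pmult_scale_left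
    by (subst 0) (simp_all add: column_mult_basis pmult_basis)
  show "omega_image n M \<star> basis_path (alpha_vee i j) = right_sum n M n \<cdot>\<^sub>p basis_path (alpha_vee i j)"
    unfolding omega_image_def pmult_add_left c pmult_scale_left
    by (subst 0) (simp_all add: column_mult_basis pmult_basis)
  show "omega_image n M \<star> basis_path (vtx j) = column n M j (j - 1)" if "j \<in> {1..n}"
    unfolding omega_image_def pmult_add_left c pmult_scale_left
    by (subst 1[OF that]) (use that in \<open>simp_all add: column_mult_basis pmult_basis\<close>)
  show "omega_image n M \<star> basis_path (vee i j) = column n M i (i - 1) \<star> basis_path (vee i j)"
    if "i \<in> {1..n}"
    unfolding omega_image_def pmult_add_left c pmult_scale_left
    by (subst 1[OF that]) (use that in \<open>simp_all add: column_mult_basis pmult_basis\<close>)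
qed

text \<open>A column of \<open>NM\<close> is a linear combination of the columns of \<open>N\<close>, with coefficients from the same column
  of \<open>M\<close>. This is the part of it that comes from the two columns belonging to \<open>k\<close>.\<close>

definition column_step :: "nat \<Rightarrow> 'k::field mat \<Rightarrow> 'k mat \<Rightarrow> nat \<Rightarrow> nat \<Rightarrow> nat \<Rightarrow> (qpath \<Rightarrow>\<^sub>0 'k)" where
  "column_step n N M j s k =
     M $$ (k - 1, s) \<cdot>\<^sub>p column n N j (k - 1) + M $$ (n + (k - 1), s) \<cdot>\<^sub>p column n N j (n + (k - 1))"

lemma column_mult:
  assumes "N \<in> carrier_mat (2 * n) (2 * n)" "M \<in> carrier_mat (2 * n) (2 * n)" "j \<in> {1..n}" "s < 2 * n"
  shows "column n (N * M) j s = (\<Sum>k\<in>{1..n}. column_step n N M j s k)"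
proof -
  have "j - 1 < 2 * n" "n + (j - 1) < 2 * n" using assms(3) by auto
  note * = this[THEN index_mat_mult_sum[OF assms(1,2)], OF assms(4)]
  have "column n (N * M) j s = (\<Sum>u<2 * n. M $$ (u, s) \<cdot>\<^sub>p column n N j u)"
    unfolding column_def *
    by (simp add: pscale_sum_left pscale_add sum.distrib mult.commute)
  also have "\<dots> = (\<Sum>k\<in>{1..n}. column_step n N M j s k)"
    unfolding sum_indices column_step_def ..
  finally show ?thesis .
qed

text \<open>In the Burt-Butler product, a tensor \<open>u \<otimes> v\<^sub>k\<^sub>j\<close> with \<open>\<phi>(u) \<in> Ae\<^sub>k\<close> contributes the column step at \<open>k\<close>.\<close>

lemma gen_image_column_vee:
  "k \<noteq> 0 \<Longrightarrow> plinear (gen_image n N) (column n M k s \<star> basis_path (vee k j)) = column_step n N M j s k"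
  by (simp add: column_mult_basis plinear_add plinear_scale column_step_def)

lemma column_eq_0:
  assumes "M \<in> large_block_alg n r" "s < 2 * n" "j \<in> {1..n}" "(vertex n s, j) \<notin> r"
  shows "column n M j s = 0"
proof -
  have "j - 1 < 2 * n" "n + (j - 1) < 2 * n" using assms(3) by auto
  then have "M $$ (j - 1, s) = 0" "M $$ (n + (j - 1), s) = 0"
    using large_block_algD(2)[OF assms(1) _ assms(2)] vertex_simps(3,4)[OF assms(3)] assms(4) by metis+
  then show ?thesis by (simp add: column_def)
qed

lemma sum_column_right:
  assumes "M \<in> large_block_alg n r" "j \<in> {1..n}"
  shows "(\<Sum>k\<in>{1..n}. column n M j (n + (k - 1))) = right_sum n M n \<cdot>\<^sub>p basis_path (alpha j)"
proof -
  have "(\<Sum>k\<in>{1..n}. column n M j (n + (k - 1))) = (\<Sum>k<n. column n M j (n + k))"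
    by (rule sum_vertices[of "\<lambda>k. column n M j (n + k)"])
  also have "\<dots> = right_sum n M (j - 1) \<cdot>\<^sub>p basis_path (vtx j) + right_sum n M (n + (j - 1)) \<cdot>\<^sub>p basis_path (alpha j)"
    by (simp add: column_def right_sum_def pscale_sum_left sum.distrib)
  also have "right_sum n M (j - 1) = 0"
    using large_block_algD(3)[OF assms(1), of "j - 1"] assms(2) by auto
  also have "right_sum n M (n + (j - 1)) = right_sum n M n"
    using large_block_algD(3)[OF assms(1), of "n + (j - 1)"] assms(2) by auto
  finally show ?thesis by simp
qed

context finite_poset
begin

lemma column_mem: "j \<in> {1..n} \<Longrightarrow> column n M j s \<in> bocs_A n r"
  by (simp add: column_def bocs_closed basis_mem)

lemma omega_image_mem: "omega_image n M \<in> bocs_A n r"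
  unfolding omega_image_def
  by (intro bocs_closed basis_mem)
    (auto simp: bocs_A_def intro!: path_alg_degree_sum column_mem[unfolded bocs_A_def])

lemma gen_image_mem: "v \<in> bocs_V n r \<Longrightarrow> plinear (gen_image n M) v \<in> bocs_A n r"
proof (induction rule: bocs_V_induct)
  case (vee i j)
  then have "j \<in> {1..n}" using range by auto
  then show ?case by (simp add: column_mem)
next
  case (alpha_vee i j)
  then have "j \<in> {1..n}" using range by auto
  then show ?case by (simp add: column_mem)
qed (auto simp: plinear_add plinear_scale bocs_closed)

text \<open>The entries of the right blocks on the diagonal are forced by those off the diagonal and the eigenvalue.\<close>

lemma column_right_split:
  assumes M: "M \<in> large_block_alg n r" and j: "j \<in> {1..n}"
  shows "right_sum n M n \<cdot>\<^sub>p basis_path (alpha j) =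
    column n M j (n + (j - 1)) + (\<Sum>h\<in>{h. (h, j) \<in> r \<and> h \<noteq> j}. column n M j (n + (h - 1)))"
proof -
  let ?S = "{h. (h, j) \<in> r \<and> h \<noteq> j}"
  have "(\<Sum>k\<in>{1..n}. column n M j (n + (k - 1))) = (\<Sum>k\<in>insert j ?S. column n M j (n + (k - 1)))"
  proof (rule sum.mono_neutral_right)
    have "column n M j (n + (k - 1)) = 0" if "k \<in> {1..n} - insert j ?S" for k
      using column_eq_0[OF M _ j, of "n + (k - 1)"] vertex_simps(4)[of k n] that by auto
    then show "\<forall>k\<in>{1..n} - insert j ?S. column n M j (n + (k - 1)) = 0" ..
  qed (use j range in auto)
  also have "\<dots> = column n M j (n + (j - 1)) + (\<Sum>k\<in>?S. column n M j (n + (k - 1)))"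
    by (rule sum.insert) (use finite_subset[of ?S "{1..n}"] range in auto)
  finally show ?thesis by (simp only: sum_column_right[OF M j])
qed

text \<open>The left-hand side is the value of \<open>\<psi>\<close>, the map of \<open>N\<close>, at \<open>a\<omega> = \<omega>a + \<delta>(a)\<close> for an element \<open>a\<close> of \<open>Ae\<^sub>j\<close>. The
  differential \<open>\<delta>(\<alpha>\<^sub>j)\<close> brings in the values of \<open>\<psi>\<close> at all \<open>\<alpha>\<^sub>hv\<^sub>h\<^sub>j\<close>, and the row sums of \<open>N\<close> combine them with
  \<open>\<psi>(\<omega>)\<alpha>\<^sub>j\<close> to the diagonal entries of \<open>N\<close> on the right.\<close>

lemma twisted_column:
  assumes N: "N \<in> large_block_alg n r" and j: "j \<in> {1..n}"
  shows "omega_image n N \<star> column n M j s + plinear (gen_image n N) (bocs_diff r (column n M j s)) =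
    column_step n N M j s j"
proof -
  have "right_sum n N n \<cdot>\<^sub>p basis_path (alpha j) - (\<Sum>h\<in>{h. (h, j) \<in> r \<and> h \<noteq> j}. column n N j (n + (h - 1))) =
      column n N j (n + (j - 1))"
    by (simp only: column_right_split[OF N j] add_diff_cancel_right')
  then have alpha: "omega_image n N \<star> basis_path (alpha j) +
      plinear (gen_image n N) (bocs_diff r (basis_path (alpha j))) = column n N j (n + (j - 1))"
    by (simp add: omega_image_mult_basis diff_path_small plinear_uminus plinear_sum del: diff_path.simps)
  have vtx: "omega_image n N \<star> basis_path (vtx j) +
      plinear (gen_image n N) (bocs_diff r (basis_path (vtx j))) = column n N j (j - 1)"
    using j by (simp add: omega_image_mult_basis)
  show ?thesis
    unfolding column_step_def vtx[symmetric] alpha[symmetric]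
    by (simp add: column_def pmult_add_right pmult_scale_right bocs_diff_linear plinear_add plinear_scale
        pscale_add del: bocs_diff_basis)
qed

text \<open>A column step at \<open>k\<close> vanishes unless \<open>i \<preceq> k\<close>, by the pattern of \<open>M\<close>, and \<open>k \<preceq> j\<close>, by that of \<open>N\<close>.\<close>

lemma column_mult_interval:
  assumes N: "N \<in> large_block_alg n r" and M: "M \<in> large_block_alg n r"
    and s: "s < 2 * n" "vertex n s = i" and ij: "(i, j) \<in> r"
  shows "column n (N * M) j s = (\<Sum>k\<in>{k. (i, k) \<in> r \<and> (k, j) \<in> r}. column_step n N M j s k)"
proof -
  have i: "i \<in> {1..n}" and j: "j \<in> {1..n}" using ij range by auto
  have "column_step n N M j s k = 0" if k: "k \<in> {1..n}" "\<not> ((i, k) \<in> r \<and> (k, j) \<in> r)" for k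
  proof (cases "(k, j) \<in> r")
    case True
    then have "(i, k) \<notin> r" using k by auto
    have "k - 1 < 2 * n" "n + (k - 1) < 2 * n" using k by auto
    then have "M $$ (k - 1, s) = 0" "M $$ (n + (k - 1), s) = 0"
      using large_block_algD(2)[OF M _ s(1)] vertex_simps(3,4)[OF k(1)] \<open>(i, k) \<notin> r\<close> s(2) by metis+
    then show ?thesis by (simp add: column_step_def)
  next
    case False
    then have "column n N j (k - 1) = 0" "column n N j (n + (k - 1)) = 0"
      using column_eq_0[OF N _ j] vertex_simps(3,4)[OF k(1)] k(1) by auto
    then show ?thesis by (simp add: column_step_def)
  qed
  then have "(\<Sum>k\<in>{1..n}. column_step n N M j s k) =
      (\<Sum>k\<in>{k. (i, k) \<in> r \<and> (k, j) \<in> r}. column_step n N M j s k)"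
    by (intro sum.mono_neutral_right) (use range in auto)
  then show ?thesis
    using column_mult[OF large_block_algD(1)[OF N] large_block_algD(1)[OF M] j s(1)] by simp
qed

text \<open>Products are compatible at \<open>\<omega>\<close>, since the interval from \<open>j\<close> to \<open>j\<close> consists of \<open>j\<close> alone.\<close>

lemma twisted_omega_image:
  assumes N: "N \<in> large_block_alg n r" and M: "M \<in> large_block_alg n r"
  shows "omega_image n N \<star> omega_image n M + plinear (gen_image n N) (bocs_diff r (omega_image n M)) =
    omega_image n (N * M)"
proof -
  have "column n (N * M) j (j - 1) = column_step n N M j (j - 1) j" if j: "j \<in> {1..n}" for j
  proof -
    have "{k. (j, k) \<in> r \<and> (k, j) \<in> r} = {j}"
      using antisym reflex[OF j] by (auto dest: antisymD)
    then show ?thesis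
      using column_mult_interval[OF N M _ vertex_simps(3)[OF j] reflex[OF j]] j by auto
  qed
  moreover have "right_sum n (N * M) n = right_sum n N n * right_sum n M n"
    using right_sum_mult[OF large_block_algD(1)[OF N] M, of n] pos by simp
  ultimately show ?thesis
    by (simp add: omega_image_def[of n M] omega_image_def[of n "N * M"] pmult_add_right pmult_scale_right
        pmult_sum_right bocs_diff_linear plinear_add plinear_scale plinear_sum omega_image_mult_basis
        twisted_column[OF N, symmetric] sum.distrib mult.commute)
qed

text \<open>The three parts will be matched with the tensors \<open>\<omega> \<otimes> v\<^sub>i\<^sub>j\<close>, \<open>v\<^sub>i\<^sub>j \<otimes> \<omega>\<close> and \<open>v\<^sub>i\<^sub>k \<otimes> v\<^sub>k\<^sub>j\<close> occurring in \<open>\<mu>(v\<^sub>i\<^sub>j)\<close>,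
  and with the corresponding ones for \<open>\<alpha>\<^sub>iv\<^sub>i\<^sub>j\<close>.\<close>

lemma column_mult_split:
  assumes N: "N \<in> large_block_alg n r" and M: "M \<in> large_block_alg n r"
    and s: "s < 2 * n" "vertex n s = i" and ij: "(i, j) \<in> r" "i \<noteq> j"
  shows "column n (N * M) j s = column_step n N M j s i + column_step n N M j s j +
    (\<Sum>k\<in>{k. (i, k) \<in> r \<and> i \<noteq> k \<and> (k, j) \<in> r \<and> k \<noteq> j}. column_step n N M j s k)"
proof -
  let ?S = "{k. (i, k) \<in> r \<and> i \<noteq> k \<and> (k, j) \<in> r \<and> k \<noteq> j}"
  have "i \<in> {1..n}" "j \<in> {1..n}" using ij range by auto
  then have "{k. (i, k) \<in> r \<and> (k, j) \<in> r} = insert i (insert j ?S)"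
    using ij reflex by auto
  moreover have "finite ?S" by (rule finite_subset[of _ "{1..n}"]) (use range in auto)
  ultimately show ?thesis
    using column_mult_interval[OF N M s ij(1)] ij(2) by (simp add: add.assoc)
qed

end

section \<open>Evaluation on the tensor product\<close>

lemma bb_eval_superset:
  assumes "finite S" "Poly_Mapping.keys z \<subseteq> S"
  shows "bb_eval r \<psi> \<phi> z = (\<Sum>(u, w)\<in>S. of_int (Poly_Mapping.lookup z (u, w)) \<cdot>\<^sub>p \<psi> (uleft r (\<phi> u) w))"
  unfolding bb_eval_def using assms
  by (intro sum.mono_neutral_left) (auto simp: in_keys_iff)

lemma bb_eval_add: "bb_eval r \<psi> \<phi> (y + z) = bb_eval r \<psi> \<phi> y + bb_eval r \<psi> \<phi> z"
proof -
  let ?S = "Poly_Mapping.keys y \<union> Poly_Mapping.keys z"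
  have "Poly_Mapping.keys (y + z) \<subseteq> ?S" by (rule Poly_Mapping.keys_add)
  then show ?thesis
    by (simp add: bb_eval_superset[of ?S] lookup_add pscale_add sum.distrib case_prod_beta)
qed

lemma bb_eval_0 [simp]: "bb_eval r \<psi> \<phi> 0 = 0"
  by (simp add: bb_eval_def)

lemma bb_eval_uminus: "bb_eval r \<psi> \<phi> (- z) = - bb_eval r \<psi> \<phi> z"
  using bb_eval_add[of r \<psi> \<phi> z "- z"] by (simp add: eq_neg_iff_add_eq_0 add.commute)

lemma bb_eval_diff: "bb_eval r \<psi> \<phi> (y - z) = bb_eval r \<psi> \<phi> y - bb_eval r \<psi> \<phi> z"
  using bb_eval_add[of r \<psi> \<phi> y "- z"] by (simp add: bb_eval_uminus)

lemma bb_eval_sum: "bb_eval r \<psi> \<phi> (sum f S) = (\<Sum>s\<in>S. bb_eval r \<psi> \<phi> (f s))"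
  by (induction S rule: infinite_finite_induct) (simp_all add: bb_eval_add)

lemma bb_eval_frag_of: "bb_eval r \<psi> \<phi> (frag_of (u, w)) = \<psi> (uleft r (\<phi> u) w)"
  by (simp add: bb_eval_def)

lemma uleft_add: "uleft r (a + a') u = uadd (uleft r a u) (uleft r a' u)"
  by (cases u) (simp add: pmult_add_left bocs_diff_linear)

lemma uleft_uadd: "uleft r a (uadd u u') = uadd (uleft r a u) (uleft r a u')"
  by (cases u; cases u') (simp add: pmult_add_right)

text \<open>That \<open>A\<close> acts on \<open>U\<close> from the left is the Leibniz rule for \<open>\<delta>\<close> in degree \<open>0\<close>.\<close>

lemma uleft_mult:
  assumes "a \<in> bocs_A n r"
  shows "uleft r (a \<star> a') u = uleft r a (uleft r a' u)"
  using assms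
  by (cases u) (simp add: bocs_A_def bocs_diff_Leibniz pmult_assoc pmult_add_left pmult_add_right add.assoc)

context finite_poset
begin

lemma bocs_U_closed:
  "u \<in> bocs_U n r \<Longrightarrow> u' \<in> bocs_U n r \<Longrightarrow> uadd u u' \<in> bocs_U n r"
  "u \<in> bocs_U n r \<Longrightarrow> a \<in> bocs_A n r \<Longrightarrow> uright u a \<in> bocs_U n r"
  "a \<in> bocs_A n r \<Longrightarrow> u \<in> bocs_U n r \<Longrightarrow> uleft r a u \<in> bocs_U n r"
  by (cases u; cases u'; auto simp: bocs_U_def bocs_closed bocs_diff_A)+

lemma right_module_mapD:
  assumes "\<phi> \<in> right_module_maps n r"
  shows "u \<in> bocs_U n r \<Longrightarrow> \<phi> u \<in> bocs_A n r"
    "u \<in> bocs_U n r \<Longrightarrow> u' \<in> bocs_U n r \<Longrightarrow> \<phi> (uadd u u') = \<phi> u + \<phi> u'"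
    "u \<in> bocs_U n r \<Longrightarrow> a \<in> bocs_A n r \<Longrightarrow> \<phi> (uright u a) = \<phi> u \<star> a"
  using assms by (auto simp: right_module_maps_def)

lemma tensor_relations_cases:
  assumes "z \<in> tensor_relations n r"
  obtains (add_left) u u' w where "z = frag_of (uadd u u', w) - frag_of (u, w) - frag_of (u', w)"
      "u \<in> bocs_U n r" "u' \<in> bocs_U n r" "w \<in> bocs_U n r"
  | (add_right) u w w' where "z = frag_of (u, uadd w w') - frag_of (u, w) - frag_of (u, w')"
      "u \<in> bocs_U n r" "w \<in> bocs_U n r" "w' \<in> bocs_U n r"
  | (balanced) u a w where "z = frag_of (uright u a, w) - frag_of (u, uleft r a w)"
      "u \<in> bocs_U n r" "a \<in> bocs_A n r" "w \<in> bocs_U n r"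
  using assms unfolding tensor_relations_def by blast

text \<open>The assignment \<open>(u, w) \<mapsto> \<psi>(\<phi>(u)w)\<close> is biadditive, and it is balanced since \<open>\<phi>(ua)w = \<phi>(u)(aw)\<close>.\<close>

lemma bb_eval_relation:
  assumes "\<psi> \<in> right_module_maps n r" "\<phi> \<in> right_module_maps n r" "z \<in> tensor_relations n r"
  shows "bb_eval r \<psi> \<phi> z = 0"
  using assms(3)
  by (cases rule: tensor_relations_cases)
    (simp_all add: bb_eval_diff bb_eval_frag_of right_module_mapD[OF assms(1)]
      right_module_mapD[OF assms(2)] bocs_U_closed uleft_add uleft_uadd uleft_mult[of _ n r])

lemma bb_eval_generate:
  assumes \<psi>: "\<psi> \<in> right_module_maps n r" and \<phi>: "\<phi> \<in> right_module_maps n r"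
    and "z \<in> generate (free_Abelian_group (bocs_U n r \<times> bocs_U n r)) (tensor_relations n r)"
  shows "bb_eval r \<psi> \<phi> z = 0"
  using assms(3)
proof (induction rule: generate.induct)
  case (inv h)
  let ?F = "free_Abelian_group (bocs_U n r \<times> bocs_U n r :: ('a bocs_elt \<times> 'a bocs_elt) set)"
  interpret group ?F by simp
  have frag: "frag_of (u, w) \<in> carrier ?F" if "u \<in> bocs_U n r" "w \<in> bocs_U n r" for u w
    using that by simp
  have diff: "x - y \<in> carrier ?F" if "x \<in> carrier ?F" "y \<in> carrier ?F" for x y
    using that keys_diff[of x y] by (auto simp: carrier_free_Abelian_group_iff)
  have "h \<in> carrier ?F"
    using inv by (cases rule: tensor_relations_cases)
      (simp_all add: diff frag bocs_U_closed del: carrier_free_Abelian_group_iff)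
  then show ?case
    by (simp add: bb_eval_uminus bb_eval_relation[OF \<psi> \<phi> inv])
qed (simp_all add: bb_eval_add bb_eval_relation[OF \<psi> \<phi>])

text \<open>By the previous lemma all formal sums in the coset \<open>\<mu>(u)\<close> have the same value, so any representative
  computes the product.\<close>

lemma bb_mult_apply:
  assumes \<psi>: "\<psi> \<in> right_module_maps n r" and \<phi>: "\<phi> \<in> right_module_maps n r"
    and u: "(b, v) \<in> bocs_U n r"
  shows "bb_mult n r \<psi> \<phi> (b, v) = bb_eval r \<psi> \<phi>
    (frag_of (omega n, (b, 0)) + split_tensor (bocs_diff r v) + frag_of (omega n, (0, v)) + frag_of ((0, v), omega n))"
    (is "_ = bb_eval r \<psi> \<phi> ?z")
proof -
  let ?F = "free_Abelian_group (bocs_U n r \<times> bocs_U n r :: ('a bocs_elt \<times> 'a bocs_elt) set)"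
  have "0 \<in> generate ?F (tensor_relations n r)"
    using generate.one[of ?F "tensor_relations n r"] by simp
  then have "bb_eval r \<psi> \<phi> ` comult n r (b, v) = {bb_eval r \<psi> \<phi> ?z}"
    by (auto simp: tensor_class_def r_coset_def bb_eval_add bb_eval_generate[OF \<psi> \<phi>] image_iff
        intro!: bexI[of _ 0])
  then show ?thesis
    using u by (simp add: bb_mult_def)
qed

end

section \<open>The product of the maps of two matrices\<close>

context finite_poset
begin

text \<open>Arrows annihilate \<open>V\<close> and the columns from the right, and \<open>Ve\<^sub>j\<close> is mapped into \<open>Ae\<^sub>j\<close>.\<close>

lemma gen_image_mult:
  assumes "v \<in> bocs_V n r" "a \<in> bocs_A n r"
  shows "plinear (gen_image n M) (v \<star> a) = plinear (gen_image n M) v \<star> a"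
  using assms(1)
proof (induction rule: bocs_V_induct)
  case (vee i j)
  then have j: "j \<noteq> 0" using range by auto
  from assms(2) show ?case
    by (induction rule: bocs_A_induct)
      (use j in \<open>simp_all add: pmult_add_right pmult_scale_right plinear_add plinear_scale pmult_basis column_mult_basis\<close>)
next
  case (alpha_vee i j)
  then have j: "j \<noteq> 0" using range by auto
  from assms(2) show ?case
    by (induction rule: bocs_A_induct)
      (use j in \<open>simp_all add: pmult_add_right pmult_scale_right plinear_add plinear_scale pmult_basis column_mult_basis\<close>)
qed (simp_all add: pmult_add_left pmult_scale_left plinear_add plinear_scale)

lemma matrix_map_right_module: "restrict (matrix_map n M) (bocs_U n r) \<in> right_module_maps n r"
proof -
  have "matrix_map n M u \<in> bocs_A n r" if "u \<in> bocs_U n r" for u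
    using that by (auto simp: bocs_U_def bocs_closed omega_image_mem gen_image_mem)
  moreover have "matrix_map n M (uadd u u') = matrix_map n M u + matrix_map n M u'" for u u'
    by (cases u; cases u') (simp add: pmult_add_right plinear_add)
  moreover have "matrix_map n M (uright u a) = matrix_map n M u \<star> a"
    if "u \<in> bocs_U n r" "a \<in> bocs_A n r" for u a
    using that by (auto simp: bocs_U_def gen_image_mult pmult_assoc pmult_add_left)
  ultimately show ?thesis
    by (auto simp: right_module_maps_def bocs_U_closed)
qed

text \<open>The summands on the right are the contributions of \<open>\<delta>(v)\<close>, \<open>\<omega> \<otimes> v\<close> and \<open>v \<otimes> \<omega>\<close> to the Burt-Butler product at
  \<open>v\<close>. For \<open>v = v\<^sub>i\<^sub>j\<close> they are the column steps at the intermediate vertices, at \<open>i\<close> and at \<open>j\<close>. For \<open>v = \<alpha>\<^sub>iv\<^sub>i\<^sub>j\<close>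
  the element \<open>\<phi>(\<omega>)\<alpha>\<^sub>i\<close> is a multiple of \<open>\<alpha>\<^sub>i\<close> that differs from the required column of \<open>M\<close> by the values
  \<open>\<phi>(\<alpha>\<^sub>hv\<^sub>h\<^sub>i)\<close>, and exactly these are removed by the terms \<open>- \<alpha>\<^sub>hv\<^sub>h\<^sub>iv\<^sub>i\<^sub>j\<close> of \<open>\<delta>(\<alpha>\<^sub>iv\<^sub>i\<^sub>j)\<close>.\<close>

lemma gen_image_mat_mult:
  assumes N: "N \<in> large_block_alg n r" and M: "M \<in> large_block_alg n r" and v: "v \<in> bocs_V n r"
  shows "plinear (gen_image n (N * M)) v =
    plinear (\<lambda>p. plinear (gen_image n N) (gen_image n M (path_front p) \<star> basis_path (path_back p))) (bocs_diff r v)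
    + plinear (gen_image n N) (omega_image n M \<star> v)
    + (omega_image n N \<star> plinear (gen_image n M) v + plinear (gen_image n N) (bocs_diff r (plinear (gen_image n M) v)))"
    (is "_ = plinear ?F _ + _ + _")
  using v
proof (induction rule: bocs_V_induct)
  case (vee i j)
  let ?K = "{k. (i, k) \<in> r \<and> i \<noteq> k \<and> (k, j) \<in> r \<and> k \<noteq> j}"
  have ij: "i \<in> {1..n}" "j \<in> {1..n}" using vee range by auto
  have K: "k \<noteq> 0" if "k \<in> ?K" for k using that range by auto
  have "plinear ?F (bocs_diff r (basis_path (vee i j))) = (\<Sum>k\<in>?K. column_step n N M j (i - 1) k)"
    unfolding bocs_diff_basis diff_path_small plinear_sum
    by (rule sum.cong) (use K in \<open>auto simp: gen_image_column_vee\<close>)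
  moreover have "plinear (gen_image n N) (omega_image n M \<star> basis_path (vee i j)) = column_step n N M j (i - 1) i"
    using ij by (simp add: omega_image_mult_basis gen_image_column_vee)
  moreover have "column n (N * M) j (i - 1) = column_step n N M j (i - 1) i + column_step n N M j (i - 1) j +
      (\<Sum>k\<in>?K. column_step n N M j (i - 1) k)"
    using column_mult_split[OF N M _ vertex_simps(3)[OF ij(1)] vee] ij by auto
  ultimately show ?case
    using twisted_column[OF N ij(2), of M "i - 1"] by (simp del: bocs_diff_basis)
next
  case (alpha_vee i j)
  let ?K = "{k. (i, k) \<in> r \<and> i \<noteq> k \<and> (k, j) \<in> r \<and> k \<noteq> j}" and ?H = "{h. (h, i) \<in> r \<and> h \<noteq> i}"
  let ?s = "n + (i - 1)"
  have ij: "i \<in> {1..n}" "j \<in> {1..n}" using alpha_vee range by auto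
  have K: "k \<noteq> 0" if "k \<in> ?K" for k using that range by auto
  have "omega_image n M \<star> basis_path (alpha_vee i j) =
      (right_sum n M n \<cdot>\<^sub>p basis_path (alpha i)) \<star> basis_path (vee i j)"
    by (simp add: omega_image_mult_basis pmult_scale_left pmult_basis)
  then have omega: "plinear (gen_image n N) (omega_image n M \<star> basis_path (alpha_vee i j)) =
      column_step n N M j ?s i +
      (\<Sum>h\<in>?H. plinear (gen_image n N) (column n M i (n + (h - 1)) \<star> basis_path (vee i j)))"
    using ij by (simp only: column_right_split[OF M ij(1)] pmult_add_left pmult_sum_left plinear_add plinear_sum)
      (simp add: gen_image_column_vee)
  have "plinear ?F (bocs_diff r (basis_path (alpha_vee i j))) =
      - (\<Sum>h\<in>?H. plinear (gen_image n N) (column n M i (n + (h - 1)) \<star> basis_path (vee i j)))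
      + (\<Sum>k\<in>?K. column_step n N M j ?s k)"
    unfolding bocs_diff_basis diff_path_small plinear_add plinear_uminus plinear_sum
    by (intro arg_cong2[of _ _ _ _ "(+)"] arg_cong[of _ _ uminus] sum.cong)
      (use K in \<open>auto simp: gen_image_column_vee\<close>)
  moreover have "column n (N * M) j ?s = column_step n N M j ?s i + column_step n N M j ?s j +
      (\<Sum>k\<in>?K. column_step n N M j ?s k)"
    using column_mult_split[OF N M _ vertex_simps(4)[OF ij(1)] alpha_vee] ij by auto
  ultimately show ?case
    using twisted_column[OF N ij(2), of M ?s] omega by (simp del: bocs_diff_basis)
qed (simp_all add: plinear_add plinear_scale pmult_add_right pmult_scale_right bocs_diff_linear pscale_add)

lemma omega_mem: "omega n \<in> bocs_U n r"
  by (simp add: omega_def bocs_U_def path_one_mem bocs_closed)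

lemma bb_mult_matrix_map:
  assumes N: "N \<in> large_block_alg n r" and M: "M \<in> large_block_alg n r"
  shows "bb_mult n r (restrict (matrix_map n N) (bocs_U n r)) (restrict (matrix_map n M) (bocs_U n r)) =
    restrict (matrix_map n (N * M)) (bocs_U n r)"
proof
  fix u :: "'a bocs_elt"
  let ?\<psi> = "restrict (matrix_map n N) (bocs_U n r)" and ?\<phi> = "restrict (matrix_map n M) (bocs_U n r)"
  show "bb_mult n r ?\<psi> ?\<phi> u = restrict (matrix_map n (N * M)) (bocs_U n r) u"
  proof (cases "u \<in> bocs_U n r")
    case True
    obtain b v where u: "u = (b, v)" by (cases u)
    have b: "b \<in> bocs_A n r" and v: "v \<in> bocs_V n r" using True by (auto simp: u bocs_U_def)
    have memU: "(b, 0) \<in> bocs_U n r" "(0, v) \<in> bocs_U n r"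
      using b v by (auto simp: bocs_U_def bocs_closed)
    have W: "omega_image n M \<in> bocs_A n r" by (rule omega_image_mem)
    have G: "plinear (gen_image n M) v \<in> bocs_A n r" by (rule gen_image_mem[OF v])
    have eval: "bb_eval r ?\<psi> ?\<phi> (frag_of (x, y)) = matrix_map n N (uleft r (matrix_map n M x) y)"
      if "x \<in> bocs_U n r" "y \<in> bocs_U n r" for x y
    proof -
      have "?\<phi> x \<in> bocs_A n r" using right_module_mapD(1)[OF matrix_map_right_module that(1)] .
      then show ?thesis using that bocs_U_closed(3)[of "?\<phi> x" y] by (simp add: bb_eval_frag_of)
    qed
    have omega: "matrix_map n M (omega n) = omega_image n M"
      using W by (simp add: omega_def path_one_right bocs_A_def)
    \<comment> \<open>The four summands of \<open>\<mu>(\<omega>b + v)\<close> are evaluated one by one.\<close>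
    have 1: "bb_eval r ?\<psi> ?\<phi> (frag_of (omega n, (b, 0))) = omega_image n (N * M) \<star> b"
      using gen_image_mult[OF bocs_diff_A[OF W] b]
      by (simp add: eval omega_mem memU omega twisted_omega_image[OF N M, symmetric] pmult_add_left pmult_assoc)
    have 2: "bb_eval r ?\<psi> ?\<phi> (frag_of (omega n, (0, v))) = plinear (gen_image n N) (omega_image n M \<star> v)"
      by (simp add: eval omega_mem memU omega)
    have 3: "bb_eval r ?\<psi> ?\<phi> (frag_of ((0, v), omega n)) = omega_image n N \<star> plinear (gen_image n M) v
        + plinear (gen_image n N) (bocs_diff r (plinear (gen_image n M) v))"
      unfolding eval[OF memU(2) omega_mem]
      using G bocs_diff_A[OF G] by (simp add: omega_def path_one_right bocs_A_def bocs_V_def)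
    have 4: "bb_eval r ?\<psi> ?\<phi> (split_tensor (bocs_diff r v)) =
      plinear (\<lambda>p. plinear (gen_image n N) (gen_image n M (path_front p) \<star> basis_path (path_back p))) (bocs_diff r v)"
      unfolding split_tensor_def bb_eval_sum plinear_def[of _ "bocs_diff r v"]
    proof (rule sum.cong[OF refl])
      fix p assume "p \<in> Poly_Mapping.keys (bocs_diff r v)"
      then have p: "is_path n r p" "path_degree p = 2"
        using bocs_diff_V[OF v] by (auto simp: path_alg_degree_def path_alg_def)
      note split = path_split[OF range p]
      have "basis_path (path_front p) \<in> (bocs_V n r :: (qpath \<Rightarrow>\<^sub>0 'a) set)"
        "basis_path (path_back p) \<in> (bocs_V n r :: (qpath \<Rightarrow>\<^sub>0 'a) set)"
        using split(1-4) unfolding bocs_V_def by (auto intro: path_alg_degree_closed)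
      then show "bb_eval r ?\<psi> ?\<phi> (frag_of ((0, Poly_Mapping.lookup (bocs_diff r v) p \<cdot>\<^sub>p basis_path (path_front p)),
            (0, basis_path (path_back p)))) =
          Poly_Mapping.lookup (bocs_diff r v) p \<cdot>\<^sub>p
            plinear (gen_image n N) (gen_image n M (path_front p) \<star> basis_path (path_back p))"
        by (subst eval) (auto simp: bocs_U_def bocs_closed plinear_scale pmult_scale_left)
    qed
    show ?thesis
      unfolding u bb_mult_apply[OF matrix_map_right_module matrix_map_right_module True[unfolded u]]
        bb_eval_add 1 2 3 4
      using True gen_image_mat_mult[OF N M v] by (simp add: u add.assoc)
  qed (simp add: bb_mult_def)
qed

end

section \<open>The matrix of a right-module map\<close>

lemma lookup_column:
  assumes "j \<in> {1..n}"
  shows "Poly_Mapping.lookup (column n M j s) (vtx j) = M $$ (j - 1, s)"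
    "Poly_Mapping.lookup (column n M j s) (alpha j) = M $$ (n + (j - 1), s)"
  by (simp_all add: column_def lookup_add lookup_single)

context finite_poset
begin

lemma bocs_A_mult_vtx:
  assumes "x \<in> bocs_A n r"
  shows "x \<star> basis_path (vtx 0) = Poly_Mapping.lookup x (vtx 0) \<cdot>\<^sub>p basis_path (vtx 0)"
    "j \<in> {1..n} \<Longrightarrow> x \<star> basis_path (vtx j) =
       Poly_Mapping.lookup x (vtx j) \<cdot>\<^sub>p basis_path (vtx j) + Poly_Mapping.lookup x (alpha j) \<cdot>\<^sub>p basis_path (alpha j)"
proof -
  show "x \<star> basis_path (vtx 0) = Poly_Mapping.lookup x (vtx 0) \<cdot>\<^sub>p basis_path (vtx 0)"
    using assms
    by (induction rule: bocs_A_induct)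
      (auto simp: pmult_add_left pmult_scale_left pmult_basis lookup_add lookup_single pscale_add when_def)
  show "x \<star> basis_path (vtx j) =
       Poly_Mapping.lookup x (vtx j) \<cdot>\<^sub>p basis_path (vtx j) + Poly_Mapping.lookup x (alpha j) \<cdot>\<^sub>p basis_path (alpha j)"
    if "j \<in> {1..n}"
    using assms
    by (induction rule: bocs_A_induct)
      (use that in \<open>auto simp: pmult_add_left pmult_scale_left pmult_basis lookup_add lookup_single pscale_add when_def\<close>)
qed

text \<open>The map determines all entries except the diagonals of the right blocks; those follow by
  \<open>column_right_split\<close>.\<close>

lemma matrix_eqI:
  assumes N: "N \<in> large_block_alg n r" and M: "M \<in> large_block_alg n r"
    and omega: "omega_image n N = omega_image n M"
    and cols: "\<And>i j. (i, j) \<in> r \<Longrightarrow> i \<noteq> j \<Longrightarrow> column n N j (i - 1) = column n M j (i - 1)"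
      "\<And>i j. (i, j) \<in> r \<Longrightarrow> i \<noteq> j \<Longrightarrow> column n N j (n + (i - 1)) = column n M j (n + (i - 1))"
  shows "N = M"
proof -
  have rs: "right_sum n N n = right_sum n M n"
  proof -
    have "right_sum n N n \<cdot>\<^sub>p basis_path (vtx 0) = right_sum n M n \<cdot>\<^sub>p basis_path (vtx 0)"
      using omega by (metis omega_image_mult_basis(1))
    then show ?thesis by (metis lookup_pscale lookup_single_eq mult.right_neutral)
  qed
  have col: "column n N j s = column n M j s" if j: "j \<in> {1..n}" and s: "s < 2 * n" for j s
  proof -
    define i where "i = vertex n s"
    have s_cases: "s = i - 1 \<or> s = n + (i - 1)" unfolding i_def by (rule index_cases[OF s]) auto
    show ?thesis
    proof (cases "(i, j) \<in> r")
      case False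
      then show ?thesis using column_eq_0[OF N s j] column_eq_0[OF M s j] by (simp add: i_def)
    next
      case ij: True
      show ?thesis
      proof (cases "i = j")
        case False
        then show ?thesis
          using s_cases cols[OF ij False] by auto
      next
        case True
        have "column n N j (j - 1) = column n M j (j - 1)"
          using omega omega_image_mult_basis(2)[OF j] by metis
        moreover have "column n N j (n + (j - 1)) = column n M j (n + (j - 1))"
        proof -
          have sums: "(\<Sum>h\<in>{h. (h, j) \<in> r \<and> h \<noteq> j}. column n N j (n + (h - 1))) =
              (\<Sum>h\<in>{h. (h, j) \<in> r \<and> h \<noteq> j}. column n M j (n + (h - 1)))"
            by (rule sum.cong) (use cols(2) in auto)
          show ?thesis
            using column_right_split[OF N j] column_right_split[OF M j] unfolding rs sums
            by (rule add_right_imp_eq[OF HOL.trans[OF sym]])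
        qed
        ultimately show ?thesis
          using s_cases True by auto
      qed
    qed
  qed
  show ?thesis
  proof (rule eq_matI)
    fix t s assume "t < dim_row M" "s < dim_col M"
    then have ts: "t < 2 * n" "s < 2 * n" using large_block_algD(1)[OF M] by auto
    define j where "j = vertex n t"
    have j: "j \<in> {1..n}" using vertex_in_range[OF ts(1)] by (simp add: j_def)
    have "t = j - 1 \<or> t = n + (j - 1)" unfolding j_def by (rule index_cases[OF ts(1)]) auto
    then show "N $$ (t, s) = M $$ (t, s)"
      using lookup_column[OF j, of N s] lookup_column[OF j, of M s] col[OF j ts(2)] by auto
  qed (use large_block_algD(1)[OF N] large_block_algD(1)[OF M] in auto)
qed

text \<open>The values at \<open>\<omega>\<close> and at the basis of \<open>V\<close> can be prescribed freely.\<close>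

lemma matrix_with_columns:
  fixes w :: "qpath \<Rightarrow>\<^sub>0 'k::field"
  assumes w: "w \<in> bocs_A n r"
    and p: "\<And>i j. (i, j) \<in> r \<Longrightarrow> p i j \<in> bocs_A n r \<and> p i j \<star> basis_path (vtx j) = p i j"
    and q: "\<And>i j. (i, j) \<in> r \<Longrightarrow> q i j \<in> bocs_A n r \<and> q i j \<star> basis_path (vtx j) = q i j"
  obtains M where "M \<in> large_block_alg n r" "omega_image n M = w"
    "\<And>i j. (i, j) \<in> r \<Longrightarrow> i \<noteq> j \<Longrightarrow> column n M j (i - 1) = p i j"
    "\<And>i j. (i, j) \<in> r \<Longrightarrow> i \<noteq> j \<Longrightarrow> column n M j (n + (i - 1)) = q i j"
proof -
  define c where "c = Poly_Mapping.lookup w (vtx 0)"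
  \<comment> \<open>The column to be realised; its diagonal value in the right half is dictated by the row sums.\<close>
  define X where "X j s = (if (vertex n s, j) \<notin> r then 0
     else if vertex n s = j then
       if s < n then w \<star> basis_path (vtx j)
       else c \<cdot>\<^sub>p basis_path (alpha j) - (\<Sum>h\<in>{h. (h, j) \<in> r \<and> h \<noteq> j}. q h j)
     else if s < n then p (vertex n s) j else q (vertex n s) j)" for j s
  define M where "M = mat (2 * n) (2 * n) (\<lambda>(t, s). Poly_Mapping.lookup (X (vertex n t) s)
     (if t < n then vtx (vertex n t) else alpha (vertex n t)))"
  have X: "X j s \<in> bocs_A n r \<and> X j s \<star> basis_path (vtx j) = X j s" if j: "j \<in> {1..n}" for j s
  proof -
    have q': "(\<Sum>h\<in>{h. (h, j) \<in> r \<and> h \<noteq> j}. q h j) \<in> bocs_A n r"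
      "(\<Sum>h\<in>{h. (h, j) \<in> r \<and> h \<noteq> j}. q h j) \<star> basis_path (vtx j) = (\<Sum>h\<in>{h. (h, j) \<in> r \<and> h \<noteq> j}. q h j)"
      using q by (auto simp: bocs_A_def pmult_sum_left intro!: path_alg_degree_sum sum.cong)
    have diff: "x - y \<in> bocs_A n r" if "x \<in> bocs_A n r" "y \<in> bocs_A n r" for x y :: "qpath \<Rightarrow>\<^sub>0 'k"
      using that path_alg_degree_closed(2)[of x n r 0 "- y"] by (simp add: bocs_A_def path_alg_degree_closed)
    have dist: "(x - y) \<star> z = x \<star> z - y \<star> z" for x y z :: "qpath \<Rightarrow>\<^sub>0 'k"
      using pmult_add_left[of x "- y" z] by (simp add: pmult_uminus)
    have 1: "c \<cdot>\<^sub>p basis_path (alpha j) - (\<Sum>h\<in>{h. (h, j) \<in> r \<and> h \<noteq> j}. q h j) \<in> bocs_A n r"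
      by (intro diff q' bocs_closed basis_mem j)
    have 2: "(c \<cdot>\<^sub>p basis_path (alpha j) - (\<Sum>h\<in>{h. (h, j) \<in> r \<and> h \<noteq> j}. q h j)) \<star> basis_path (vtx j) =
      c \<cdot>\<^sub>p basis_path (alpha j) - (\<Sum>h\<in>{h. (h, j) \<in> r \<and> h \<noteq> j}. q h j)"
      by (simp only: dist q' pmult_scale_left) (simp add: pmult_basis)
    have 3: "w \<star> basis_path (vtx j) \<in> bocs_A n r" using j by (intro bocs_closed w basis_mem) auto
    have 4: "w \<star> basis_path (vtx j) \<star> basis_path (vtx j) = w \<star> basis_path (vtx j)"
      by (simp add: pmult_assoc pmult_basis)
    show ?thesis
      unfolding X_def using 1 2 3 4 p q by (auto simp: bocs_closed)
  qed
  have carrier: "M \<in> carrier_mat (2 * n) (2 * n)" by (simp add: M_def)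
  have col: "column n M j s = X j s" if j: "j \<in> {1..n}" and s: "s < 2 * n" for j s
  proof -
    have "j - 1 < n" "vertex n (j - 1) = j" "vertex n (n + (j - 1)) = j" "n + (j - 1) < 2 * n"
      using j vertex_simps(3,4)[OF j] by auto
    then have "column n M j s = Poly_Mapping.lookup (X j s) (vtx j) \<cdot>\<^sub>p basis_path (vtx j) +
        Poly_Mapping.lookup (X j s) (alpha j) \<cdot>\<^sub>p basis_path (alpha j)"
      using s by (simp add: column_def M_def del: One_nat_def)
    also have "\<dots> = X j s \<star> basis_path (vtx j)"
      using bocs_A_mult_vtx(2)[OF _ j] X[OF j] by metis
    finally show ?thesis using X[OF j] by simp
  qed
  have entry: "M $$ (t, s) = (if t < n then Poly_Mapping.lookup (X (vertex n t) s) (vtx (vertex n t))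
      else Poly_Mapping.lookup (X (vertex n t) s) (alpha (vertex n t)))" if "t < 2 * n" "s < 2 * n" for t s
    using that by (simp add: M_def)
  have sum_X: "(\<Sum>k<n. X j (n + k)) = c \<cdot>\<^sub>p basis_path (alpha j)" if j: "j \<in> {1..n}" for j
  proof -
    let ?S = "{h. (h, j) \<in> r \<and> h \<noteq> j}"
    have fin: "finite ?S" by (rule finite_subset[of _ "{1..n}"]) (use range in auto)
    have Xk: "X j (n + (k - 1)) = (if (k, j) \<notin> r then 0 else if k = j
        then c \<cdot>\<^sub>p basis_path (alpha j) - (\<Sum>h\<in>?S. q h j) else q k j)" if "k \<in> {1..n}" for k
      using vertex_simps(4)[OF that] by (simp add: X_def del: One_nat_def)
    have "(\<Sum>k<n. X j (n + k)) = (\<Sum>k\<in>{1..n}. X j (n + (k - 1)))"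
      by (rule sum_vertices[of "\<lambda>k. X j (n + k)", symmetric])
    also have "\<dots> = (\<Sum>k\<in>insert j ?S. X j (n + (k - 1)))"
      by (rule sum.mono_neutral_right) (use j range Xk in auto)
    also have "\<dots> = X j (n + (j - 1)) + (\<Sum>k\<in>?S. X j (n + (k - 1)))"
      by (rule sum.insert) (use fin in auto)
    also have "(\<Sum>k\<in>?S. X j (n + (k - 1))) = (\<Sum>h\<in>?S. q h j)"
      by (rule sum.cong) (use Xk range in auto)
    also have "X j (n + (j - 1)) = c \<cdot>\<^sub>p basis_path (alpha j) - (\<Sum>h\<in>?S. q h j)"
      using Xk[OF j] reflex[OF j] by simp
    finally show ?thesis by simp
  qed
  have right: "right_sum n M t = (if t < n then 0 else c)" if t: "t < 2 * n" for t
  proof -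
    define x where "x = (if t < n then vtx (vertex n t) else alpha (vertex n t))"
    have "right_sum n M t = (\<Sum>k<n. Poly_Mapping.lookup (X (vertex n t) (n + k)) x)"
      unfolding right_sum_def by (rule sum.cong) (use t entry in \<open>auto simp: x_def\<close>)
    also have "\<dots> = Poly_Mapping.lookup (\<Sum>k<n. X (vertex n t) (n + k)) x"
      by (simp add: lookup_sum)
    also have "\<dots> = (if t < n then 0 else c)"
      unfolding sum_X[OF vertex_in_range[OF t]] by (simp add: x_def lookup_single when_def)
    finally show ?thesis .
  qed
  have large: "M \<in> large_block_alg n r"
  proof -
    have "(vertex n s, vertex n t) \<in> r" if "t < 2 * n" "s < 2 * n" "M $$ (t, s) \<noteq> 0" for t s
      using that entry[OF that(1,2)] by (auto simp: X_def split: if_splits)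
    then show ?thesis
      using carrier right by (auto simp: mem_large_block_alg_iff)
  qed
  have diag: "column n M j (j - 1) = w \<star> basis_path (vtx j)" if j: "j \<in> {1..n}" for j
  proof -
    have "j - 1 < n" using j by auto
    then have "X j (j - 1) = w \<star> basis_path (vtx j)"
      unfolding X_def vertex_simps(3)[OF j] using reflex[OF j] by simp
    then show ?thesis using col[OF j, of "j - 1"] \<open>j - 1 < n\<close> by simp
  qed
  have "omega_image n M = c \<cdot>\<^sub>p basis_path (vtx 0) + (\<Sum>j\<in>{1..n}. column n M j (j - 1))"
    using right[of n] pos by (simp add: omega_image_def)
  also have "(\<Sum>j\<in>{1..n}. column n M j (j - 1)) = (\<Sum>j\<in>{1..n}. w \<star> basis_path (vtx j))"
    by (rule sum.cong[OF HOL.refl diag])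
  also have "c \<cdot>\<^sub>p basis_path (vtx 0) = w \<star> basis_path (vtx 0)"
    using bocs_A_mult_vtx(1)[OF w] by (simp add: c_def)
  also have "w \<star> basis_path (vtx 0) + (\<Sum>j\<in>{1..n}. w \<star> basis_path (vtx j)) = w \<star> path_one n"
    by (simp add: path_one_def pmult_add_right pmult_sum_right sum.atLeast_Suc_atMost[of 0 n])
  also have "w \<star> path_one n = w" using path_one_right w by (auto simp: bocs_A_def)
  finally have "omega_image n M = w" .
  moreover have "column n M j (i - 1) = p i j" "column n M j (n + (i - 1)) = q i j"
    if ij: "(i, j) \<in> r" "i \<noteq> j" for i j
  proof -
    have i: "i \<in> {1..n}" and j: "j \<in> {1..n}" using ij range by auto
    then have lt: "i - 1 < n" by auto
    then have "X j (i - 1) = p i j" "X j (n + (i - 1)) = q i j"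
      unfolding X_def vertex_simps(3,4)[OF i] using ij by simp_all
    then show "column n M j (i - 1) = p i j" "column n M j (n + (i - 1)) = q i j"
      using col[OF j, of "i - 1"] col[OF j, of "n + (i - 1)"] lt by simp_all
  qed
  ultimately show ?thesis by (intro that[OF large])
qed

text \<open>Scalars act through \<open>A\<close>, as \<open>cu = u(c1)\<close>, so additive right-module maps are linear.\<close>

lemma right_module_map_scale:
  assumes "\<phi> \<in> right_module_maps n r" "(b, v) \<in> bocs_U n r"
  shows "\<phi> (c \<cdot>\<^sub>p b, c \<cdot>\<^sub>p v) = c \<cdot>\<^sub>p \<phi> (b, v)"
proof -
  have one: "x \<star> (c \<cdot>\<^sub>p path_one n) = c \<cdot>\<^sub>p x" if "x \<in> path_alg_degree n r d" for x :: "qpath \<Rightarrow>\<^sub>0 'a" and d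
    using path_one_right[OF that] by (simp add: pmult_scale_right)
  have "uright (b, v) (c \<cdot>\<^sub>p path_one n) = (c \<cdot>\<^sub>p b, c \<cdot>\<^sub>p v)"
    using assms(2) one by (auto simp: bocs_U_def bocs_A_def bocs_V_def)
  moreover have "c \<cdot>\<^sub>p path_one n \<in> bocs_A n r"
    by (intro bocs_closed path_one_mem)
  moreover have "\<phi> (b, v) \<star> (c \<cdot>\<^sub>p path_one n) = c \<cdot>\<^sub>p \<phi> (b, v)"
    using one right_module_mapD(1)[OF assms] by (auto simp: bocs_A_def)
  ultimately show ?thesis
    using right_module_mapD(3)[OF assms, of "c \<cdot>\<^sub>p path_one n"] by simp
qed

lemma bij_betw_matrix_map:
  "bij_betw (\<lambda>M. restrict (matrix_map n M) (bocs_U n r)) (large_block_alg n r)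
     (right_module_maps n r :: ('k::field bocs_elt \<Rightarrow> _) set)"
proof (rule bij_betw_imageI)
  show "inj_on (\<lambda>M. restrict (matrix_map n M) (bocs_U n r)) (large_block_alg n r :: 'k mat set)"
  proof (rule inj_onI)
    fix N M :: "'k mat"
    assume N: "N \<in> large_block_alg n r" and M: "M \<in> large_block_alg n r"
      and eq: "restrict (matrix_map n N) (bocs_U n r) = restrict (matrix_map n M) (bocs_U n r)"
    have eq: "matrix_map n N u = matrix_map n M u" if "u \<in> bocs_U n r" for u
      using that fun_cong[OF eq, of u] by simp
    have omega: "matrix_map n L (omega n) = omega_image n L" for L :: "'k mat"
      using omega_image_mem[of L] by (simp add: omega_def path_one_right bocs_A_def)
    show "N = M"
    proof (rule matrix_eqI[OF N M])
      show "omega_image n N = omega_image n M"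
        using eq[OF omega_mem] by (simp add: omega)
      fix i j assume ij: "(i, j) \<in> r" "i \<noteq> j"
      have "(0, basis_path (vee i j)) \<in> bocs_U n r" "(0, basis_path (alpha_vee i j)) \<in> bocs_U n r"
        using ij by (auto simp: bocs_U_def bocs_closed basis_mem)
      from this[THEN eq] show "column n N j (i - 1) = column n M j (i - 1)"
        "column n N j (n + (i - 1)) = column n M j (n + (i - 1))" by simp_all
    qed
  qed
  show "(\<lambda>M. restrict (matrix_map n M) (bocs_U n r)) ` large_block_alg n r =
    (right_module_maps n r :: ('k bocs_elt \<Rightarrow> _) set)"
  proof (intro subset_antisym subsetI)
    fix \<phi> :: "'k bocs_elt \<Rightarrow> _" assume \<phi>: "\<phi> \<in> right_module_maps n r"
    note D = right_module_mapD[OF \<phi>]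
    define p where "p i j = (if i = j then 0 else \<phi> (0, basis_path (vee i j)))" for i j
    define q where "q i j = (if i = j then 0 else \<phi> (0, basis_path (alpha_vee i j)))" for i j
    have mem: "(0, v) \<in> bocs_U n r" if "v \<in> bocs_V n r" for v
      using that by (simp add: bocs_U_def bocs_closed)
    have pq: "\<phi> (0, v) \<in> bocs_A n r \<and> \<phi> (0, v) \<star> basis_path (vtx j) = \<phi> (0, v)"
      if "v \<in> bocs_V n r" "v \<star> basis_path (vtx j) = v" "j \<le> n" for v j
      using D(1)[OF mem[OF that(1)]] D(3)[OF mem[OF that(1)] basis_mem(1)[OF that(3)]] that(2) by simp
    obtain M where M: "M \<in> large_block_alg n r" "omega_image n M = \<phi> (omega n)"
      "\<And>i j. (i, j) \<in> r \<Longrightarrow> i \<noteq> j \<Longrightarrow> column n M j (i - 1) = p i j"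
      "\<And>i j. (i, j) \<in> r \<Longrightarrow> i \<noteq> j \<Longrightarrow> column n M j (n + (i - 1)) = q i j"
    proof (rule matrix_with_columns)
      show "\<phi> (omega n) \<in> bocs_A n r" by (rule D(1)[OF omega_mem])
      fix i j assume ij: "(i, j) \<in> r"
      then have "j \<le> n" using range by auto
      then show "p i j \<in> bocs_A n r \<and> p i j \<star> basis_path (vtx j) = p i j"
        "q i j \<in> bocs_A n r \<and> q i j \<star> basis_path (vtx j) = q i j"
        using pq[OF basis_mem(3)[OF ij], of j] pq[OF basis_mem(4)[OF ij], of j]
        by (auto simp: p_def q_def bocs_closed pmult_basis)
    next
      fix M :: "'k mat"
      assume "M \<in> large_block_alg n r" "omega_image n M = \<phi> (omega n)"
        "\<And>i j. (i, j) \<in> r \<Longrightarrow> i \<noteq> j \<Longrightarrow> column n M j (i - 1) = p i j"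
        "\<And>i j. (i, j) \<in> r \<Longrightarrow> i \<noteq> j \<Longrightarrow> column n M j (n + (i - 1)) = q i j"
      then show thesis by (rule that)
    qed
    have gen: "plinear (gen_image n M) v = \<phi> (0, v)" if "v \<in> bocs_V n r" for v
    proof -
      have "v \<in> bocs_V n r \<and> plinear (gen_image n M) v = \<phi> (0, v)"
        using that
      proof (induction rule: bocs_V_induct)
        case zero
        then show ?case
          using right_module_map_scale[OF \<phi> mem[OF bocs_closed(2)], of 0] by (simp add: bocs_closed)
      next
        case (add x y)
        then show ?case
          using D(2)[OF mem mem, of x y] by (simp add: plinear_add bocs_closed)
      next
        case (scale c x)
        then show ?case
          using right_module_map_scale[OF \<phi> mem, of x c] by (simp add: plinear_scale bocs_closed)
      qed (use M(3,4) in \<open>auto simp: basis_mem p_def q_def\<close>)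
      then show ?thesis ..
    qed
    have "matrix_map n M u = \<phi> u" if "u \<in> bocs_U n r" for u
    proof -
      obtain b v where u: "u = (b, v)" by (cases u)
      have b: "b \<in> bocs_A n r" and v: "v \<in> bocs_V n r" using that by (auto simp: u bocs_U_def)
      have "u = uadd (uright (omega n) b) (0, v)"
        using path_one_left[of b 0] b by (simp add: u omega_def bocs_A_def)
      then have "\<phi> u = \<phi> (omega n) \<star> b + \<phi> (0, v)"
        using D(2)[OF bocs_U_closed(2)[OF omega_mem b] mem[OF v]] D(3)[OF omega_mem b] by simp
      then show ?thesis using gen[OF v] by (simp add: u M(2))
    qed
    then have "restrict (matrix_map n M) (bocs_U n r) = \<phi>"
      using \<phi> by (intro extensionalityI[of _ "bocs_U n r"]) (auto simp: right_module_maps_def PiE_def)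
    then show "\<phi> \<in> (\<lambda>M. restrict (matrix_map n M) (bocs_U n r)) ` large_block_alg n r"
      using M(1) by blast
  qed (auto simp: matrix_map_right_module)
qed

section \<open>The isomorphisms\<close>

lemma column_linear:
  assumes "N \<in> carrier_mat (2 * n) (2 * n)" "M \<in> carrier_mat (2 * n) (2 * n)" "j \<in> {1..n}" "s < 2 * n"
  shows "column n (N + M) j s = column n N j s + column n M j s"
    "column n (c \<cdot>\<^sub>m M) j s = c \<cdot>\<^sub>p column n M j s"
    "column n (0\<^sub>m (2 * n) (2 * n)) j s = 0"
proof -
  have "j - 1 < 2 * n" "n + (j - 1) < 2 * n" using assms(3) by auto
  then show "column n (N + M) j s = column n N j s + column n M j s"
    "column n (c \<cdot>\<^sub>m M) j s = c \<cdot>\<^sub>p column n M j s"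
    "column n (0\<^sub>m (2 * n) (2 * n)) j s = 0"
    using assms by (simp_all add: column_def pscale_add add_ac)
qed

lemma column_one:
  assumes "j \<in> {1..n}" "i \<in> {1..n}"
  shows "column n (1\<^sub>m (2 * n)) j (i - 1) = (if i = j then basis_path (vtx j) else 0)"
    "column n (1\<^sub>m (2 * n)) j (n + (i - 1)) = (if i = j then basis_path (alpha j) else 0)"
proof -
  have "j - 1 < n" "i - 1 < n" "i - 1 = j - 1 \<longleftrightarrow> i = j" using assms by auto
  then show "column n (1\<^sub>m (2 * n)) j (i - 1) = (if i = j then basis_path (vtx j) else 0)"
    "column n (1\<^sub>m (2 * n)) j (n + (i - 1)) = (if i = j then basis_path (alpha j) else 0)"
    by (auto simp: column_def simp del: One_nat_def)
qed

lemma right_sum_linear: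
  assumes "N \<in> carrier_mat (2 * n) (2 * n)" "M \<in> carrier_mat (2 * n) (2 * n)"
  shows "right_sum n (N + M) n = right_sum n N n + right_sum n M n"
    "right_sum n (c \<cdot>\<^sub>m M) n = c * right_sum n M n"
    "right_sum n (0\<^sub>m (2 * n) (2 * n)) n = 0"
  using assms pos by (simp_all add: right_sum_def sum.distrib sum_distrib_left)

lemma right_sum_one: "right_sum n (1\<^sub>m (2 * n)) n = 1"
proof -
  have "right_sum n (1\<^sub>m (2 * n)) n = (\<Sum>k<n. if k = 0 then 1 else 0)"
    unfolding right_sum_def by (rule sum.cong) auto
  then show ?thesis using pos by simp
qed

lemma omega_image_linear:
  fixes N M :: "'k::field mat"
  assumes "N \<in> carrier_mat (2 * n) (2 * n)" "M \<in> carrier_mat (2 * n) (2 * n)"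
  shows "omega_image n (N + M) = omega_image n N + omega_image n M"
    "omega_image n (c \<cdot>\<^sub>m M) = c \<cdot>\<^sub>p omega_image n M"
    "omega_image n (0\<^sub>m (2 * n) (2 * n) :: 'k mat) = 0"
    "omega_image n (1\<^sub>m (2 * n)) = (path_one n :: qpath \<Rightarrow>\<^sub>0 'k)"
proof -
  have *: "column n (N + M) j (j - 1) = column n N j (j - 1) + column n M j (j - 1)"
    "column n (c \<cdot>\<^sub>m M) j (j - 1) = c \<cdot>\<^sub>p column n M j (j - 1)"
    "column n (0\<^sub>m (2 * n) (2 * n)) j (j - 1) = 0"
    if "j \<in> {1..n}" for j c
  proof -
    have "j - 1 < 2 * n" using that by auto
    then show "column n (N + M) j (j - 1) = column n N j (j - 1) + column n M j (j - 1)"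
      "column n (c \<cdot>\<^sub>m M) j (j - 1) = c \<cdot>\<^sub>p column n M j (j - 1)"
      "column n (0\<^sub>m (2 * n) (2 * n)) j (j - 1) = 0"
      by (simp_all only: column_linear[OF assms that])
  qed
  have sums: "(\<Sum>j\<in>{1..n}. column n (N + M) j (j - 1)) =
      (\<Sum>j\<in>{1..n}. column n N j (j - 1) + column n M j (j - 1))"
    "(\<Sum>j\<in>{1..n}. column n (c \<cdot>\<^sub>m M) j (j - 1)) = (\<Sum>j\<in>{1..n}. c \<cdot>\<^sub>p column n M j (j - 1))"
    "(\<Sum>j\<in>{1..n}. column n (0\<^sub>m (2 * n) (2 * n)) j (j - 1)) = (\<Sum>j\<in>{1..n}. 0 :: qpath \<Rightarrow>\<^sub>0 'k)"
    by (rule sum.cong[OF HOL.refl], rule *, assumption)+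
  show "omega_image n (N + M) = omega_image n N + omega_image n M"
    "omega_image n (c \<cdot>\<^sub>m M) = c \<cdot>\<^sub>p omega_image n M"
    "omega_image n (0\<^sub>m (2 * n) (2 * n) :: 'k mat) = 0"
    unfolding omega_image_def right_sum_linear[OF assms] sums
    by (simp_all add: sum.distrib pscale_add pscale_sum add_ac)
  have "(\<Sum>j\<in>{1..n}. column n (1\<^sub>m (2 * n)) j (j - 1)) = (\<Sum>j\<in>{1..n}. basis_path (vtx j))"
    by (rule sum.cong[OF refl]) (simp add: column_one del: One_nat_def)
  then show "omega_image n (1\<^sub>m (2 * n)) = (path_one n :: qpath \<Rightarrow>\<^sub>0 'k)"
    by (simp add: omega_image_def right_sum_one path_one_def sum.atLeast_Suc_atMost[of 0 n])
qed

lemma gen_image_linear: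
  fixes N M :: "'k::field mat"
  assumes "N \<in> carrier_mat (2 * n) (2 * n)" "M \<in> carrier_mat (2 * n) (2 * n)" and v: "v \<in> bocs_V n r"
  shows "plinear (gen_image n (N + M)) v = plinear (gen_image n N) v + plinear (gen_image n M) v"
    "plinear (gen_image n (c \<cdot>\<^sub>m M)) v = c \<cdot>\<^sub>p plinear (gen_image n M) v"
    "plinear (gen_image n (0\<^sub>m (2 * n) (2 * n))) v = 0"
    "plinear (gen_image n (1\<^sub>m (2 * n))) v = 0"
proof -
  have idx: "i \<in> {1..n} \<and> j \<in> {1..n} \<and> i - 1 < 2 * n \<and> n + (i - 1) < 2 * n" if "(i, j) \<in> r" for i j
    using that range by force
  note lin = column_linear[OF assms(1,2)]
  have sum: "column n (N + M) j (i - 1) = column n N j (i - 1) + column n M j (i - 1)"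
      "column n (N + M) j (n + (i - 1)) = column n N j (n + (i - 1)) + column n M j (n + (i - 1))"
    if "(i, j) \<in> r" for i j
    using lin(1)[of j "i - 1"] lin(1)[of j "n + (i - 1)"] idx[OF that] by (simp_all del: One_nat_def)
  have scaled: "column n (c \<cdot>\<^sub>m M) j (i - 1) = c \<cdot>\<^sub>p column n M j (i - 1)"
      "column n (c \<cdot>\<^sub>m M) j (n + (i - 1)) = c \<cdot>\<^sub>p column n M j (n + (i - 1))"
    if "(i, j) \<in> r" for i j
    using lin(2)[of j "i - 1"] lin(2)[of j "n + (i - 1)"] idx[OF that] by (simp_all del: One_nat_def)
  have null: "column n (0\<^sub>m (2 * n) (2 * n) :: 'k mat) j (i - 1) = 0"
      "column n (0\<^sub>m (2 * n) (2 * n) :: 'k mat) j (n + (i - 1)) = 0"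
    if "(i, j) \<in> r" for i j
    using lin(3)[of j "i - 1"] lin(3)[of j "n + (i - 1)"] idx[OF that] by (simp_all del: One_nat_def)
  have unit: "column n (1\<^sub>m (2 * n) :: 'k mat) j (i - 1) = 0" "column n (1\<^sub>m (2 * n) :: 'k mat) j (n + (i - 1)) = 0"
    if "(i, j) \<in> r" "i \<noteq> j" for i j
  proof -
    have "j \<in> {1..n}" "i \<in> {1..n}" using idx[OF that(1)] by auto
    then show "column n (1\<^sub>m (2 * n) :: 'k mat) j (i - 1) = 0" "column n (1\<^sub>m (2 * n) :: 'k mat) j (n + (i - 1)) = 0"
      by (simp_all only: column_one that(2) if_False)
  qed
  show "plinear (gen_image n (N + M)) v = plinear (gen_image n N) v + plinear (gen_image n M) v"
    using v
  proof (induction rule: bocs_V_induct)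
    case (add x y)
    then show ?case by (simp add: plinear_add add_ac)
  qed (simp_all add: plinear_scale pscale_add sum del: One_nat_def)
  show "plinear (gen_image n (c \<cdot>\<^sub>m M)) v = c \<cdot>\<^sub>p plinear (gen_image n M) v"
    using v by (induction rule: bocs_V_induct)
      (simp_all add: plinear_add plinear_scale pscale_add scaled mult.commute del: One_nat_def)
  show "plinear (gen_image n (0\<^sub>m (2 * n) (2 * n))) v = 0"
    using v by (induction rule: bocs_V_induct)
      (simp_all add: plinear_add plinear_scale null del: One_nat_def)
  show "plinear (gen_image n (1\<^sub>m (2 * n))) v = 0"
    using v by (induction rule: bocs_V_induct)
      (simp_all add: plinear_add plinear_scale unit del: One_nat_def)
qed

lemma k_algebra_large_block_alg:
  "k_algebra (module_mat TYPE('k::field) (2 * n) (2 * n) \<lparr>carrier := large_block_alg n r\<rparr>)"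
  by (rule k_algebra_subalgebra[OF k_algebra_module_mat k_subalgebra_large_block_alg[OF trans reflex]])

lemma large_block_alg_isomorphic_left_Burt_Butler:
  "k_algebra_isomorphic (module_mat TYPE('k::field) (2 * n) (2 * n) \<lparr>carrier := large_block_alg n r\<rparr>)
     (left_Burt_Butler n r)"
proof (rule k_algebra_transport(1)[OF k_algebra_large_block_alg,
      where g = "\<lambda>M. restrict (matrix_map n M) (bocs_U n r)"])
  fix N M :: "'k mat"
  let ?R = "module_mat TYPE('k) (2 * n) (2 * n) \<lparr>carrier := large_block_alg n r\<rparr>"
  assume "N \<in> carrier ?R" "M \<in> carrier ?R"
  then have NM: "N \<in> large_block_alg n r" "M \<in> large_block_alg n r" by simp_all
  note c = NM[THEN large_block_algD(1)]
  show "restrict (matrix_map n (N \<otimes>\<^bsub>?R\<^esub> M)) (bocs_U n r) =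
      restrict (matrix_map n N) (bocs_U n r) \<otimes>\<^bsub>left_Burt_Butler n r\<^esub> restrict (matrix_map n M) (bocs_U n r)"
    by (simp add: left_Burt_Butler_def module_mat_simps bb_mult_matrix_map[OF NM])
  show "restrict (matrix_map n (N \<oplus>\<^bsub>?R\<^esub> M)) (bocs_U n r) =
      restrict (matrix_map n N) (bocs_U n r) \<oplus>\<^bsub>left_Burt_Butler n r\<^esub> restrict (matrix_map n M) (bocs_U n r)"
    by (auto simp: left_Burt_Butler_def module_mat_simps bocs_U_def omega_image_linear[OF c]
        gen_image_linear[OF c] pmult_add_left intro!: restrict_ext)
next
  fix M :: "'k mat" and c :: 'k
  let ?R = "module_mat TYPE('k) (2 * n) (2 * n) \<lparr>carrier := large_block_alg n r\<rparr>"
  assume "M \<in> carrier ?R"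
  then have M: "M \<in> carrier_mat (2 * n) (2 * n)" by (simp add: large_block_algD(1))
  show "restrict (matrix_map n (c \<odot>\<^bsub>?R\<^esub> M)) (bocs_U n r) =
      c \<odot>\<^bsub>left_Burt_Butler n r\<^esub> restrict (matrix_map n M) (bocs_U n r)"
    by (auto simp: left_Burt_Butler_def module_mat_simps bocs_U_def omega_image_linear[OF M M]
        gen_image_linear[OF M M] pmult_scale_left pscale_add intro!: restrict_ext)
next
  let ?R = "module_mat TYPE('k) (2 * n) (2 * n) \<lparr>carrier := large_block_alg n r\<rparr>"
  let ?Z = "0\<^sub>m (2 * n) (2 * n) :: 'k mat"
  have Z: "?Z \<in> carrier_mat (2 * n) (2 * n)" by simp
  show "restrict (matrix_map n \<one>\<^bsub>?R\<^esub>) (bocs_U n r) = \<one>\<^bsub>left_Burt_Butler n r\<^esub>"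
    by (auto simp: left_Burt_Butler_def module_mat_simps bocs_U_def omega_image_linear[OF Z Z]
        gen_image_linear[OF Z Z] path_one_left bocs_A_def intro!: restrict_ext)
  show "restrict (matrix_map n \<zero>\<^bsub>?R\<^esub>) (bocs_U n r) = \<zero>\<^bsub>left_Burt_Butler n r\<^esub>"
    by (auto simp: left_Burt_Butler_def module_mat_simps bocs_U_def omega_image_linear[OF Z Z]
        gen_image_linear[OF Z Z] intro!: restrict_ext)
qed (simp add: left_Burt_Butler_def bij_betw_matrix_map)

end

text \<open>The elements of degree \<open>0\<close> are the same for all orders on \<open>{1..n}\<close>, so \<open>A\<close> may be computed with the equality
  order. Its \<open>V\<close> is zero, so \<open>\<delta>\<close> vanishes on \<open>A\<close> and \<open>twisted_omega_image\<close> says that taking the value at \<open>\<omega>\<close> is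
  multiplicative.\<close>

lemma bocs_A_algebra_isomorphic_small_block_alg:
  assumes "finite_poset n r"
  shows "k_algebra_isomorphic (bocs_A_algebra n r)
    (module_mat TYPE('k::field) (2 * n) (2 * n) \<lparr>carrier := small_block_alg n\<rparr>)"
proof -
  let ?r = "Id_on {1..n}"
  interpret P: finite_poset n r by (rule assms)
  interpret D: finite_poset n ?r
    by unfold_locales (use P.pos in \<open>auto intro: antisymI transI\<close>)
  have A: "bocs_A n r = (bocs_A n ?r :: (qpath \<Rightarrow>\<^sub>0 'k) set)"
  proof (intro subset_antisym subsetI)
    show "x \<in> bocs_A n ?r" if "x \<in> bocs_A n r" for x :: "qpath \<Rightarrow>\<^sub>0 'k"
      using that by (induction rule: P.bocs_A_induct) (simp_all add: D.bocs_closed D.basis_mem del: One_nat_def)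
    show "x \<in> bocs_A n r" if "x \<in> bocs_A n ?r" for x :: "qpath \<Rightarrow>\<^sub>0 'k"
      using that by (induction rule: D.bocs_A_induct) (simp_all add: P.bocs_closed P.basis_mem del: One_nat_def)
  qed
  have V: "v = 0" if "v \<in> bocs_V n ?r" for v :: "qpath \<Rightarrow>\<^sub>0 'k"
    using that by (induction rule: D.bocs_V_induct) auto
  let ?R = "module_mat TYPE('k) (2 * n) (2 * n) \<lparr>carrier := large_block_alg n ?r\<rparr>"
  have "bij_betw (omega_image n) (large_block_alg n ?r) (bocs_A n ?r :: (qpath \<Rightarrow>\<^sub>0 'k) set)"
  proof (rule bij_betw_imageI)
    show "inj_on (omega_image n) (large_block_alg n ?r :: 'k mat set)"
      by (intro inj_onI D.matrix_eqI) auto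
    have "\<exists>M. M \<in> large_block_alg n ?r \<and> omega_image n M = w" if "w \<in> bocs_A n ?r" for w :: "qpath \<Rightarrow>\<^sub>0 'k"
      by (rule D.matrix_with_columns[OF that, of "\<lambda>_ _. 0" "\<lambda>_ _. 0"]) (auto simp: D.bocs_closed simp del: One_nat_def)
    then show "omega_image n ` large_block_alg n ?r = (bocs_A n ?r :: (qpath \<Rightarrow>\<^sub>0 'k) set)"
      by (auto simp: D.omega_image_mem simp del: One_nat_def)
  qed
  then have bij: "bij_betw (omega_image n) (carrier ?R) (carrier (bocs_A_algebra n r))"
    by (simp add: bocs_A_algebra_def A)
  have iso: "k_algebra_isomorphic (bocs_A_algebra n r) ?R"
  proof (rule k_algebra_transport(2)[OF D.k_algebra_large_block_alg bij])
    fix N M :: "'k mat" assume "N \<in> carrier ?R" "M \<in> carrier ?R"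
    then have NM: "N \<in> large_block_alg n ?r" "M \<in> large_block_alg n ?r" by simp_all
    note c = NM[THEN large_block_algD(1)]
    show "omega_image n (N \<oplus>\<^bsub>?R\<^esub> M) = omega_image n N \<oplus>\<^bsub>bocs_A_algebra n r\<^esub> omega_image n M"
      by (simp add: module_mat_simps bocs_A_algebra_def D.omega_image_linear[OF c])
    have "bocs_diff ?r (omega_image n M) = 0"
      by (rule V[OF D.bocs_diff_A[OF D.omega_image_mem]])
    then show "omega_image n (N \<otimes>\<^bsub>?R\<^esub> M) = omega_image n N \<otimes>\<^bsub>bocs_A_algebra n r\<^esub> omega_image n M"
      using D.twisted_omega_image[OF NM] by (simp add: module_mat_simps bocs_A_algebra_def)
  next
    fix M :: "'k mat" and c :: 'k assume "M \<in> carrier ?R"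
    then have M: "M \<in> carrier_mat (2 * n) (2 * n)" by (simp add: large_block_algD(1))
    show "omega_image n (c \<odot>\<^bsub>?R\<^esub> M) = c \<odot>\<^bsub>bocs_A_algebra n r\<^esub> omega_image n M"
      by (simp add: module_mat_simps bocs_A_algebra_def D.omega_image_linear[OF M M])
  next
    have Z: "(0\<^sub>m (2 * n) (2 * n) :: 'k mat) \<in> carrier_mat (2 * n) (2 * n)" by simp
    show "omega_image n \<one>\<^bsub>?R\<^esub> = \<one>\<^bsub>bocs_A_algebra n r\<^esub>" "omega_image n \<zero>\<^bsub>?R\<^esub> = \<zero>\<^bsub>bocs_A_algebra n r\<^esub>"
      by (simp_all add: module_mat_simps bocs_A_algebra_def D.omega_image_linear[OF Z Z])
  qed
  show ?thesis using iso by (simp only: small_block_alg_eq)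
qed

theorem theorem2p4:
  fixes n :: nat and r :: "nat rel"
  assumes "n \<ge> 1"
    and "partial_order_on {1..n} r"
    and "\<And>i j. (i, j) \<in> r \<Longrightarrow> i \<le> j"
  shows "k_subalgebra (small_block_alg n) (module_mat TYPE('k::field) (2 * n) (2 * n))
    \<and> k_subalgebra (large_block_alg n r) (module_mat TYPE('k) (2 * n) (2 * n))
    \<and> (small_block_alg n :: 'k mat set) \<subseteq> large_block_alg n r
    \<and> k_algebra_isomorphic (bocs_A_algebra n r)
        (module_mat TYPE('k) (2 * n) (2 * n) \<lparr>carrier := small_block_alg n\<rparr>)
    \<and> k_algebra_isomorphic
        (module_mat TYPE('k) (2 * n) (2 * n) \<lparr>carrier := large_block_alg n r\<rparr>)
        (left_Burt_Butler n r)"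
proof -
  have refl: "refl_on {1..n} r" and r: "trans r" "antisym r" "r \<subseteq> {1..n} \<times> {1..n}"
    using partial_order_onD[OF assms(2)] by auto
  have Id: "Id_on {1..n} \<subseteq> r" using refl by (auto dest: refl_onD)
  interpret finite_poset n r
    by unfold_locales (use assms(1) r refl in \<open>auto dest: refl_onD\<close>)
  have "k_subalgebra (small_block_alg n) (module_mat TYPE('k) (2 * n) (2 * n))"
    unfolding small_block_alg_eq
    by (rule k_subalgebra_large_block_alg) (auto intro: transI)
  moreover have "k_subalgebra (large_block_alg n r) (module_mat TYPE('k) (2 * n) (2 * n))"
    by (rule k_subalgebra_large_block_alg[OF trans reflex])
  moreover have "(small_block_alg n :: 'k mat set) \<subseteq> large_block_alg n r"
    unfolding small_block_alg_eq by (rule large_block_alg_mono[OF Id])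
  ultimately show ?thesis
    using bocs_A_algebra_isomorphic_small_block_alg[OF finite_poset_axioms]
      large_block_alg_isomorphic_left_Burt_Butler by blast
qed

end
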